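(* Let $q\ge 2$ be an integer and let $n\ge n_0(q)$, where $n_0(2)=37$, $n_0(3)=97$, and $n_0(q)=45q-8$ for $q\ge4$. If $G$ is an oriented graph on $n$ vertices with $\delta^0(G)\ge\lceil n/3\rceil$, then every vertex of $G$ lies on a copy of $C_{3q}$ in $G$.
   Context: An oriented graph is an orientation of a (finite) simple graph: no loops, and at most one arc on each unordered pair of vertices. For a vertex $v$, $d^+(v)$ and $d^-(v)$ are its outdegree and indegree, and $\delta^0(G)=\min_{v}\min\{d^+(v),d^-(v)\}$ is the minimum semidegree. $C_\ell$ denotes the consistently oriented (directed) cycle of length $\ell$ (with $\ell$ distinct vertices). *)

theory Defs
  imports Complex_Main "Graph_Theory.Graph_Theory"
begin

(* The locale digraph already provides finiteness, no loops and no parallel arcs;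
   excluding opposite arcs leaves at most one arc on each unordered pair. *)
locale oriented_graph = digraph +
  assumes no_opposite_arcs: "(u, v) \<in> arcs_ends G \<Longrightarrow> (v, u) \<notin> arcs_ends G"

(* As with Min, the value is meaningful only for a finite nonempty vertex set. *)
definition min_semidegree :: "('a, 'b) pre_digraph \<Rightarrow> nat" where
  "min_semidegree G = Min ((\<lambda>v. min (out_degree G v) (in_degree G v)) ` verts G)"

(* A copy of the directed cycle of length l is given by its arc list p: the library predicate
   cycle requires a closed directed walk whose length p vertices are pairwise distinct.
   These vertices are exactly the tails of the arcs of p. *)
definition lies_on_directed_cycle :: "('a, 'b) pre_digraph \<Rightarrow> nat \<Rightarrow> 'a \<Rightarrow> bool" where
  "lies_on_directed_cycle G l v \<longleftrightarrow>
     (\<exists>p. pre_digraph.cycle G p \<and> length p = l \<and> v \<in> tail G ` set p)"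

(* Only meaningful for q \<ge> 2. *)
definition n0 :: "nat \<Rightarrow> nat" where
  "n0 q = (if q = 2 then 37 else if q = 3 then 97 else 45 * q - 8)"

end

(* Let d be the minimum semidegree, so that there are at most 3d vertices, and let A and B be the
   out- and in-neighbourhood of v.

   If A contains an arc (a, s) and B contains an arc (y, b), then a and b are optional vertices of
   a closed walk v, a, s, ..., y, b, v, so it suffices to connect s to y by a path of one of three
   consecutive lengths. By counting arcs, the first two levels around a vertex contain about 3d/2
   vertices, the first three about 2d, and already the first two about 2d if the neighbourhood is
   independent. If the out-neighbourhood of s is independent, then two levels at s and two levels at
   y exceed the number of vertices and hence meet; otherwise it contains an arc, which yields a
   third optional vertex, and three levels on one side meet two on the other. For q = 2 a finer
   count of the arcs between the levels is needed.

   If A is independent, then equality holds everywhere: A has d elements, and each of them is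
   joined to every vertex outside A, to half of them in each direction. In particular every vertex of
   A has an out-neighbour in B. The cycle is built backwards from such an arc, alternating between
   A and single vertices or arcs outside A. Independent B is the same after reversing all arcs. *)

theory Submission
  imports Defs
begin

section \<open>Neighbourhoods and arc counting\<close>

definition outn :: "('a \<Rightarrow> 'a \<Rightarrow> bool) \<Rightarrow> 'a \<Rightarrow> 'a set" where
  "outn E x = {y. E x y}"

definition inn :: "('a \<Rightarrow> 'a \<Rightarrow> bool) \<Rightarrow> 'a \<Rightarrow> 'a set" where
  "inn E x = {y. E y x}"

definition arc_count :: "('a \<Rightarrow> 'a \<Rightarrow> bool) \<Rightarrow> 'a set \<Rightarrow> 'a set \<Rightarrow> nat" where
  "arc_count E X Y = (\<Sum>x\<in>X. card (outn E x \<inter> Y))"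

lemma in_outn [simp]: "y \<in> outn E x \<longleftrightarrow> E x y"
  by (simp add: outn_def)

lemma in_inn [simp]: "y \<in> inn E x \<longleftrightarrow> E y x"
  by (simp add: inn_def)

lemma outn_conversep [simp]: "outn E\<inverse>\<inverse> = inn E"
  by (auto simp: fun_eq_iff)

lemma inn_conversep [simp]: "inn E\<inverse>\<inverse> = outn E"
  by (auto simp: fun_eq_iff)

lemma arc_count_eq_card:
  assumes "finite X" "finite Y"
  shows "arc_count E X Y = card {p \<in> X \<times> Y. E (fst p) (snd p)}"
proof -
  have "{p \<in> X \<times> Y. E (fst p) (snd p)} = Sigma X (\<lambda>x. outn E x \<inter> Y)"
    by auto
  with assms show ?thesis
    by (simp add: arc_count_def)
qed

lemma arc_count_conversep:
  assumes "finite X" "finite Y"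
  shows "arc_count E\<inverse>\<inverse> Y X = arc_count E X Y"
proof -
  have "{p \<in> Y \<times> X. E\<inverse>\<inverse> (fst p) (snd p)} = prod.swap ` {p \<in> X \<times> Y. E (fst p) (snd p)}"
    by (auto simp: image_iff)
  then show ?thesis
    using assms by (simp add: arc_count_eq_card card_image)
qed

lemma arc_count_Un_right:
  assumes "finite Y" "finite Z" "Y \<inter> Z = {}"
  shows "arc_count E X (Y \<union> Z) = arc_count E X Y + arc_count E X Z"
  using assms
  by (simp add: arc_count_def Int_Un_distrib card_Un_disjoint disjoint_iff sum.distrib)

lemma arc_count_Un_left:
  assumes "finite X" "finite Y" "X \<inter> Y = {}"
  shows "arc_count E (X \<union> Y) Z = arc_count E X Z + arc_count E Y Z"
  using assms by (simp add: arc_count_def sum.union_disjoint)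

lemma arc_count_ge:
  assumes "finite X" "\<And>x. x \<in> X \<Longrightarrow> m \<le> card (outn E x \<inter> Y)"
  shows "card X * m \<le> arc_count E X Y"
  using sum_bounded_below[of X m "\<lambda>x. card (outn E x \<inter> Y)"] assms
  by (simp add: arc_count_def)

lemma arc_count_le:
  assumes "\<And>x. x \<in> X \<Longrightarrow> card (outn E x \<inter> Y) \<le> m"
  shows "arc_count E X Y \<le> card X * m"
  using sum_bounded_above[of X "\<lambda>x. card (outn E x \<inter> Y)" m] assms
  by (simp add: arc_count_def)

lemma arc_count_le_card:
  assumes "finite Y"
  shows "arc_count E X Y \<le> card X * card Y"
  by (rule arc_count_le) (simp add: assms card_mono)

text \<open>The arcs from \<open>X\<close> to \<open>Y\<close> and the reversals of the arcs from
  \<open>Y\<close> to \<open>X\<close> are disjoint sets of pairs in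
  \<open>X \<times> Y\<close>.\<close>

lemma arc_count_antiparallel:
  assumes "finite X" "finite Y" "\<And>x y. E x y \<Longrightarrow> \<not> E y x"
  shows "arc_count E X Y + arc_count E Y X \<le> card X * card Y"
proof -
  let ?A = "{p \<in> X \<times> Y. E (fst p) (snd p)}" and ?B = "{p \<in> X \<times> Y. E\<inverse>\<inverse> (fst p) (snd p)}"
  have "arc_count E Y X = arc_count E\<inverse>\<inverse> X Y"
    using arc_count_conversep[OF assms(2,1), of E] by simp
  then have "arc_count E X Y + arc_count E Y X = card ?A + card ?B"
    using assms(1,2) by (simp add: arc_count_eq_card)
  also have "\<dots> = card (?A \<union> ?B)"
    by (rule card_Un_disjoint[symmetric]) (use assms in auto)
  also have "\<dots> \<le> card (X \<times> Y)"
    by (rule card_mono) (use assms in auto)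
  finally show ?thesis
    by (simp add: card_cartesian_product)
qed

text \<open>Arcs, reversed arcs and the diagonal are pairwise disjoint in
  \<open>X \<times> X\<close>.\<close>

lemma arc_count_self:
  assumes "finite X" "\<And>x y. E x y \<Longrightarrow> \<not> E y x"
  shows "2 * arc_count E X X + card X \<le> card X * card X"
proof -
  let ?A = "{p \<in> X \<times> X. E (fst p) (snd p)}" and ?B = "{p \<in> X \<times> X. E\<inverse>\<inverse> (fst p) (snd p)}"
  have irr: "\<not> E x x" for x
    using assms(2) by blast
  have "2 * arc_count E X X = card ?A + card ?B"
    using assms(1) arc_count_conversep[OF assms(1,1), of E] by (simp add: arc_count_eq_card)
  also have "\<dots> = card (?A \<union> ?B)"
    by (rule card_Un_disjoint[symmetric]) (use assms in auto)
  finally have "2 * arc_count E X X + card X = card (?A \<union> ?B) + card ((\<lambda>x. (x, x)) ` X)"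
    by (simp add: card_image inj_on_def)
  also have "\<dots> = card (?A \<union> ?B \<union> (\<lambda>x. (x, x)) ` X)"
    by (rule card_Un_disjoint[symmetric]) (use assms irr in auto)
  also have "\<dots> \<le> card (X \<times> X)"
    by (rule card_mono) (use assms in auto)
  finally show ?thesis
    by (simp add: card_cartesian_product)
qed

text \<open>Averaging: \<open>X\<close> spans at most \<open>|X| (|X| - 1) / 2\<close> arcs, so some
  outdegree inside \<open>X\<close> is at most \<open>(|X| - 1) / 2\<close>.\<close>

lemma ex_small_outdegree:
  assumes "finite X" "X \<noteq> {}" "\<And>x y. E x y \<Longrightarrow> \<not> E y x"
  shows "\<exists>x\<in>X. 2 * card (outn E x \<inter> X) + 1 \<le> card X"
proof (rule ccontr)
  assume "\<not> ?thesis"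
  then have "card X \<le> 2 * card (outn E x \<inter> X)" if "x \<in> X" for x
    using that by fastforce
  then have "(\<Sum>x\<in>X. card X) \<le> (\<Sum>x\<in>X. 2 * card (outn E x \<inter> X))"
    by (rule sum_mono)
  then have "card X * card X \<le> 2 * arc_count E X X"
    by (simp add: arc_count_def sum_distrib_left)
  moreover have "2 * arc_count E X X + card X \<le> card X * card X"
    by (rule arc_count_self) (use assms in auto)
  ultimately have "card X = 0"
    by linarith
  with assms show False by simp
qed

section \<open>Sizes of the first levels around a set\<close>

text \<open>This is the next breadth-first level inside \<open>U\<close>; the converse relation
  gives the levels of in-neighbours.\<close>

definition boundary :: "('a \<Rightarrow> 'a \<Rightarrow> bool) \<Rightarrow> 'a set \<Rightarrow> 'a set \<Rightarrow> 'a set" where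
  "boundary E U X = {y \<in> U - X. \<exists>x\<in>X. E x y}"

lemma finite_boundary: "finite U \<Longrightarrow> finite (boundary E U X)"
  by (simp add: boundary_def)

lemma boundary_subset: "boundary E U X \<subseteq> U"
  by (auto simp: boundary_def)

lemma card_Un_boundary: "finite U \<Longrightarrow> X \<subseteq> U \<Longrightarrow> card (X \<union> boundary E U X) = card X + card (boundary E U X)"
  by (rule card_Un_disjoint) (auto simp: boundary_def finite_subset)

text \<open>A vertex of \<open>Z\<close> with at most \<open>(|Z| - 1) / 2\<close> out-neighbours in
  \<open>Z\<close> sends the rest of its \<open>m\<close> arcs to the boundary.\<close>

lemma two_levels:
  assumes "finite U" "Z \<subseteq> U" "Z \<noteq> {}" "\<And>x y. E x y \<Longrightarrow> \<not> E y x"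
    and "\<And>z. z \<in> Z \<Longrightarrow> m \<le> card (outn E z \<inter> U)"
  shows "card Z + 2 * m + 1 \<le> 2 * card (Z \<union> boundary E U Z)"
proof -
  have fin: "finite Z" "finite (boundary E U Z)"
    using assms(1,2) finite_subset by (auto simp: boundary_def)
  obtain x where x: "x \<in> Z" "2 * card (outn E x \<inter> Z) + 1 \<le> card Z"
    using ex_small_outdegree[OF fin(1) assms(3), of E] assms(4) by blast
  have "m \<le> card (outn E x \<inter> U)"
    using assms(5) x by blast
  also have "\<dots> \<le> card ((outn E x \<inter> Z) \<union> boundary E U Z)"
    by (rule card_mono) (use fin x in \<open>auto simp: boundary_def\<close>)
  also have "\<dots> \<le> card (outn E x \<inter> Z) + card (boundary E U Z)"
    by (rule card_Un_le)
  finally show ?thesis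
    using x(2) card_Un_boundary[OF assms(1,2), of E] by simp
qed

lemma two_levels_independent:
  assumes "finite U" "Z \<subseteq> U" "Z \<noteq> {}" "\<And>x y. x \<in> Z \<Longrightarrow> y \<in> Z \<Longrightarrow> \<not> E x y"
    and "\<And>z. z \<in> Z \<Longrightarrow> m \<le> card (outn E z \<inter> U)"
  shows "card Z + m \<le> card (Z \<union> boundary E U Z)"
proof -
  have fin: "finite Z" "finite (boundary E U Z)"
    using assms(1,2) finite_subset by (auto simp: boundary_def)
  obtain x where x: "x \<in> Z"
    using assms(3) by blast
  have "m \<le> card (outn E x \<inter> U)"
    using assms(5) x by blast
  also have "\<dots> \<le> card (boundary E U Z)"
    by (rule card_mono) (use fin x assms(4) in \<open>auto simp: boundary_def\<close>)
  finally show ?thesis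
    using card_Un_boundary[OF assms(1,2), of E] by simp
qed

text \<open>\<open>Z\<close> sends no arc to the third level, so every arc leaving the first two levels starts in \<open>Q\<close>.\<close>

lemma three_levels:
  assumes "finite U" "Z \<subseteq> U" "\<And>x y. E x y \<Longrightarrow> \<not> E y x"
    and deg: "\<And>x. x \<in> U \<Longrightarrow> m \<le> card (outn E x \<inter> U)"
    and "m \<le> card Z + 3" "7 \<le> m"
  defines "Q \<equiv> boundary E U Z"
  shows "2 * m \<le> card (Z \<union> Q \<union> boundary E U (Z \<union> Q))"
proof (rule ccontr)
  assume lt: "\<not> ?thesis"
  let ?R = "boundary E U (Z \<union> Q)"
  have sub: "Q \<subseteq> U" "?R \<subseteq> U"
    by (auto simp: boundary_def Q_def)
  have fin: "finite Z" "finite Q" "finite ?R"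
    using assms(1,2) sub finite_subset by blast+
  have disj: "Z \<inter> Q = {}" "(Z \<union> Q) \<inter> ?R = {}"
    by (auto simp: boundary_def Q_def)
  have "outn E x \<inter> U = outn E x \<inter> (Z \<union> Q \<union> ?R)" if "x \<in> Z \<union> Q" for x
    using that assms(2) sub unfolding boundary_def by auto
  then have "card (Z \<union> Q) * m \<le> arc_count E (Z \<union> Q) (Z \<union> Q \<union> ?R)"
    using deg assms(2) sub fin by (intro arc_count_ge) (metis Un_least finite_UnI subsetD)+
  also have "\<dots> = arc_count E (Z \<union> Q) (Z \<union> Q) + arc_count E (Z \<union> Q) ?R"
    using fin disj by (intro arc_count_Un_right) auto
  also have "arc_count E (Z \<union> Q) ?R = arc_count E Z ?R + arc_count E Q ?R"
    using fin disj by (intro arc_count_Un_left) auto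
  also have "arc_count E Z ?R = 0"
    using fin by (auto simp: arc_count_def boundary_def Q_def)
  finally have 1: "card (Z \<union> Q) * m \<le> arc_count E (Z \<union> Q) (Z \<union> Q) + card Q * card ?R"
    using arc_count_le_card[OF fin(3), of E Q] by simp
  have 2: "2 * arc_count E (Z \<union> Q) (Z \<union> Q) + card (Z \<union> Q) \<le> card (Z \<union> Q) * card (Z \<union> Q)"
    using fin assms(3) by (intro arc_count_self) auto
  define M k z r where "M = int (card (Z \<union> Q))" and "k = int (card Q)" and "z = int (card Z)"
    and "r = int (card ?R)"
  have M: "M = z + k"
    using fin disj by (simp add: M_def k_def z_def card_Un_disjoint)
  have nn: "z \<ge> 0" "k \<ge> 0" "r \<ge> 0"
    by (auto simp: k_def z_def r_def)
  have 3: "M + r < 2 * int m"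
    using lt fin disj by (simp add: M_def r_def card_Un_disjoint)
  have "int (2 * (card (Z \<union> Q) * m) + card (Z \<union> Q))
      \<le> int (card (Z \<union> Q) * card (Z \<union> Q) + 2 * (card Q * card ?R))"
    using 1 2 by (intro of_nat_mono) linarith
  then have 4: "2 * M * int m + M \<le> M * M + 2 * k * r"
    unfolding M_def k_def r_def of_nat_add of_nat_mult by (simp add: algebra_simps)
  \<comment> \<open>\<open>e\<close> is the amount by which the first two levels fall short of
    \<open>2m\<close>. Both \<open>r\<close> and \<open>k\<close> are bounded in terms of it (the
    latter because \<open>Z\<close> has at least \<open>m - 3\<close> elements), which leaves a
    quadratic inequality in \<open>e\<close>.\<close>
  define e where "e = 2 * int m - M"
  have e: "r \<le> e - 1" "k \<le> int m - e + 3"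
    using 3 M assms(5) unfolding e_def z_def by linarith+
  have "k * r \<le> k * (e - 1)"
    using e nn by (simp add: mult_left_mono)
  also have "\<dots> \<le> (int m - e + 3) * (e - 1)"
    using e nn by (simp add: mult_right_mono)
  finally have "M * (e + 1) \<le> 2 * ((int m - e + 3) * (e - 1))"
    using 4 by (simp add: e_def algebra_simps)
  then have "e * e - 9 * e + 4 * int m + 6 \<le> 0"
    by (simp add: e_def algebra_simps)
  \<comment> \<open>Completing the square: \<open>e * e - 9 * e\<close> is at least
    \<open>-81/4\<close>, so the quadratic is positive for \<open>m \<ge> 7\<close>.\<close>
  moreover have "0 \<le> (2 * e - 9) * (2 * e - 9)"
    by simp
  then have "36 * e \<le> 4 * (e * e) + 81"
    by (simp add: algebra_simps)
  ultimately show False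
    using assms(6) by linarith
qed

section \<open>Cycles as vertex lists and connections through overlapping levels\<close>

definition on_cycle :: "('a \<Rightarrow> 'a \<Rightarrow> bool) \<Rightarrow> nat \<Rightarrow> 'a \<Rightarrow> bool" where
  "on_cycle E l v \<longleftrightarrow> (\<exists>xs. distinct xs \<and> length xs = l \<and> v \<in> set xs \<and>
     successively E xs \<and> E (last xs) (hd xs))"

lemma on_cycleI:
  "distinct xs \<Longrightarrow> length xs = l \<Longrightarrow> v \<in> set xs \<Longrightarrow> successively E xs \<Longrightarrow> E (last xs) (hd xs) \<Longrightarrow>
    on_cycle E l v"
  by (auto simp: on_cycle_def)

text \<open>The reversed vertex list is a cycle of \<open>E\<close>. This turns results on
  out-neighbourhoods into results on in-neighbourhoods.\<close>

lemma on_cycle_conversep: "on_cycle E\<inverse>\<inverse> l v \<Longrightarrow> on_cycle E l v"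
proof -
  assume "on_cycle E\<inverse>\<inverse> l v"
  then obtain xs where xs: "distinct xs" "length xs = l" "v \<in> set xs" "successively E\<inverse>\<inverse> xs"
    "E\<inverse>\<inverse> (last xs) (hd xs)"
    by (auto simp: on_cycle_def)
  have "successively E (rev xs)"
    using xs(4) by (simp add: conversep.simps[abs_def])
  with xs show ?thesis
    by (intro on_cycleI[of "rev xs"]) (auto simp: last_rev hd_rev)
qed

text \<open>By pigeonhole, the two levels out of \<open>Z\<close> and the two levels into
  \<open>W\<close> share a vertex, which is reached by a path of at most two arcs.\<close>

lemma short_connection:
  assumes "finite U" "Z \<subseteq> U" "W \<subseteq> U"
    and "card U < card (Z \<union> boundary E U Z) + card (W \<union> boundary E\<inverse>\<inverse> U W)"
  shows "Z \<inter> W \<noteq> {} \<or> (\<exists>z\<in>Z. \<exists>w\<in>W. E z w) \<or> (\<exists>z\<in>Z. \<exists>p\<in>U. \<exists>w\<in>W. E z p \<and> E p w)"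
proof -
  have "(Z \<union> boundary E U Z) \<inter> (W \<union> boundary E\<inverse>\<inverse> U W) \<noteq> {}"
  proof
    assume "(Z \<union> boundary E U Z) \<inter> (W \<union> boundary E\<inverse>\<inverse> U W) = {}"
    moreover have "finite Z" "finite W"
      using assms finite_subset by auto
    ultimately have "card (Z \<union> boundary E U Z) + card (W \<union> boundary E\<inverse>\<inverse> U W)
        = card ((Z \<union> boundary E U Z) \<union> (W \<union> boundary E\<inverse>\<inverse> U W))"
      using assms(1) by (simp add: card_Un_disjoint finite_boundary)
    also have "\<dots> \<le> card U"
      using assms by (intro card_mono) (auto simp: boundary_def)
    finally show False
      using assms(4) by simp
  qed
  then show ?thesis
    unfolding boundary_def by blast
qed

text \<open>The same pigeonhole argument with a third level on the side of \<open>Z\<close>.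
  Distinctness is part of the last alternative because a walk with three arcs may close to a
  triangle, whereas asymmetry excludes repetitions in shorter ones.\<close>

lemma long_connection:
  assumes "finite U" "Z \<subseteq> U" "W \<subseteq> U" and asym: "\<And>x y. E x y \<Longrightarrow> \<not> E y x"
    and "card U < card (Z \<union> boundary E U Z \<union> boundary E U (Z \<union> boundary E U Z)) + card (W \<union> boundary E\<inverse>\<inverse> U W)"
  shows "Z \<inter> W \<noteq> {} \<or> (\<exists>z\<in>Z. \<exists>w\<in>W. E z w) \<or> (\<exists>z\<in>Z. \<exists>p\<in>U. \<exists>w\<in>W. E z p \<and> E p w) \<or>
    (\<exists>z\<in>Z. \<exists>p\<in>U. \<exists>p'\<in>U. \<exists>w\<in>W. E z p \<and> E p p' \<and> E p' w \<and> distinct [z, p, p', w])"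
proof -
  let ?Q = "boundary E U Z" and ?R = "boundary E U (Z \<union> boundary E U Z)" and ?Y = "W \<union> boundary E\<inverse>\<inverse> U W"
  have "(Z \<union> ?Q \<union> ?R) \<inter> ?Y \<noteq> {}"
  proof
    assume "(Z \<union> ?Q \<union> ?R) \<inter> ?Y = {}"
    moreover have "finite Z" "finite W"
      using assms(1-3) finite_subset by blast+
    ultimately have "card (Z \<union> ?Q \<union> ?R) + card ?Y = card ((Z \<union> ?Q \<union> ?R) \<union> ?Y)"
      using assms(1) by (simp add: card_Un_disjoint finite_boundary)
    also have "\<dots> \<le> card U"
      using assms(1-3) by (intro card_mono) (auto simp: boundary_def)
    finally show False
      using assms(5) by simp
  qed
  \<comment> \<open>A meeting in the first two levels is treated first; in the other cases its
    absence separates \<open>z\<close> and \<open>p\<close> from \<open>w\<close>.\<close>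
  then consider "(Z \<union> ?Q) \<inter> ?Y \<noteq> {}" | "?R \<inter> W \<noteq> {}" "(Z \<union> ?Q) \<inter> ?Y = {}"
    | "?R \<inter> boundary E\<inverse>\<inverse> U W \<noteq> {}" "(Z \<union> ?Q) \<inter> ?Y = {}"
    by blast
  then show ?thesis
  proof cases
    case 1
    then show ?thesis
      unfolding boundary_def by blast
  next
    case 2
    then obtain r where r: "r \<in> ?R" "r \<in> W"
      by blast
    then obtain p where "p \<in> Z \<union> ?Q" "E p r"
      unfolding boundary_def[of E U "Z \<union> ?Q"] by blast
    with r(2) show ?thesis
      unfolding boundary_def by blast
  next
    case 3
    then obtain r where r0: "r \<in> ?R" "r \<in> boundary E\<inverse>\<inverse> U W"
      by blast
    obtain w where w: "w \<in> W" "E r w"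
      using r0(2) unfolding boundary_def by blast
    obtain p where "p \<in> Z \<union> ?Q" "E p r" "r \<in> U"
      using r0(1) unfolding boundary_def[of E U "Z \<union> ?Q"] by blast
    note r = r0(1) w this
    show ?thesis
    proof (cases "p \<in> Z")
      case True
      with r show ?thesis
        by blast
    next
      case False
      with r obtain z where z: "z \<in> Z" "E z p" "p \<in> U" "p \<in> ?Q"
        by (auto simp: boundary_def)
      have "z \<noteq> r"
        using r z unfolding boundary_def by blast
      moreover have "z \<noteq> w" "p \<noteq> w"
        using r z 3(2) by auto
      moreover have "z \<noteq> p" "p \<noteq> r" "r \<noteq> w"
        using z r asym by blast+
      ultimately have "distinct [z, p, r, w]"
        by simp
      with r z show ?thesis
        by blast
    qed
  qed
qed

text \<open>The right-hand side grows with \<open>k\<close> up to \<open>k = (c + 1) / 2\<close>,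
  where it equals \<open>(c + 1) (3c + 1) / 4\<close>. Cancelling \<open>c + 1\<close> gives
  \<open>c \<le> 9\<close>. This is the final contradiction for cycles of length 6, with
  \<open>c\<close> the semidegree bound.\<close>

lemma quadratic_window_bound:
  fixes c k :: nat
  assumes "10 \<le> c" "2 * k \<le> c + 1" "(c - 2) * (c + 1) \<le> k * (2 * c + 1 - k)"
  shows False
proof -
  have "k \<le> 2 * c + 1" "2 \<le> c"
    using assms by auto
  then have "int ((c - 2) * (c + 1)) = (int c - 2) * (int c + 1)"
    "int (k * (2 * c + 1 - k)) = int k * (2 * int c + 1 - int k)"
    unfolding of_nat_mult by (simp_all add: of_nat_diff)
  with of_nat_mono[OF assms(3), where 'a = int]
  have 1: "(int c - 2) * (int c + 1) \<le> int k * (2 * int c + 1 - int k)"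
    by (simp only:)
  \<comment> \<open>The product is the difference between four times the maximal value and four
    times the value at \<open>k\<close>.\<close>
  have "(int c + 1 - 2 * int k) * (3 * int c + 1 - 2 * int k) \<ge> 0"
    using assms(1,2) by (intro mult_nonneg_nonneg) auto
  then have "4 * (int k * (2 * int c + 1 - int k)) \<le> (int c + 1) * (3 * int c + 1)"
    by (simp add: algebra_simps)
  with 1 have "4 * ((int c - 2) * (int c + 1)) \<le> (int c + 1) * (3 * int c + 1)"
    by linarith
  then have "(int c + 1) * (4 * (int c - 2)) \<le> (int c + 1) * (3 * int c + 1)"
    by (simp add: algebra_simps)
  then have "4 * (int c - 2) \<le> 3 * int c + 1"
    by (subst (asm) mult_le_cancel_left_pos) auto
  then show False
    using assms(1) by simp
qed

section \<open>Oriented graphs of large minimum semidegree\<close>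

locale semidegree_graph =
  fixes V :: "'a set" and E :: "'a \<Rightarrow> 'a \<Rightarrow> bool" and d :: nat
  assumes finite_V: "finite V"
    and wf: "E x y \<Longrightarrow> x \<in> V \<and> y \<in> V"
    and asym: "E x y \<Longrightarrow> \<not> E y x"
    and card_V: "card V \<le> 3 * d"
    and outdeg: "x \<in> V \<Longrightarrow> d \<le> card (outn E x)"
    and indeg: "x \<in> V \<Longrightarrow> d \<le> card (inn E x)"
begin

lemma irrefl: "\<not> E x x"
  using asym by blast

text \<open>The hypotheses are symmetric under reversal of arcs, so each result on out-neighbours
  has a dual.\<close>

lemma converse_graph: "semidegree_graph V E\<inverse>\<inverse> d"
proof unfold_locales
  show "E\<inverse>\<inverse> x y \<Longrightarrow> x \<in> V \<and> y \<in> V" "E\<inverse>\<inverse> x y \<Longrightarrow> \<not> E\<inverse>\<inverse> y x" for x y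
    using wf asym unfolding conversep_iff by blast+
qed (simp_all add: finite_V card_V outdeg indeg)

lemma outn_subset: "outn E x \<subseteq> V" and inn_subset: "inn E x \<subseteq> V"
  using wf unfolding outn_def inn_def by blast+

lemma finite_outn: "finite (outn E x)" and finite_inn: "finite (inn E x)"
  by (rule finite_subset[OF outn_subset finite_V] finite_subset[OF inn_subset finite_V])+

lemma card_outn_Diff:
  assumes "x \<in> V" "finite F" "card (outn E x \<inter> F) \<le> k"
  shows "d - k \<le> card (outn E x - F)"
proof -
  have "card (outn E x - F) = card (outn E x) - card (outn E x \<inter> F)"
    by (rule card_Diff_subset_Int) (simp add: finite_outn)
  then show ?thesis
    using outdeg[OF assms(1)] assms(3) by linarith
qed

lemma card_outn_Diff':
  assumes "x \<in> V" "finite F"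
  shows "d - card F \<le> card (outn E x \<inter> (V - F))"
proof -
  have "outn E x \<inter> (V - F) = outn E x - F"
    using outn_subset by auto
  then show ?thesis
    using card_outn_Diff[OF assms(1,2), of "card F"] assms(2) by (simp add: card_mono)
qed

section \<open>Cycles through arcs in both neighbourhoods\<close>

text \<open>Greedy extension at the front: the head has at least \<open>d\<close> in-neighbours and
  is not one of them itself, so \<open>F\<close> and the rest of the path cannot contain them
  all.\<close>

lemma backward_path:
  assumes "y \<in> V" "y \<notin> F" "finite F" "card F + l < d"
  shows "\<exists>ys. length ys = l + 1 \<and> distinct ys \<and> successively E ys \<and> last ys = y \<and>
    set ys \<subseteq> V \<and> set ys \<inter> F = {}"
  using assms(4)
proof (induction l)
  case 0
  then show ?case
    using assms by (intro exI[of _ "[y]"]) auto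
next
  case (Suc l)
  then obtain ys where ys: "length ys = l + 1" "distinct ys" "successively E ys" "last ys = y"
    "set ys \<subseteq> V" "set ys \<inter> F = {}"
    by auto
  then have ne: "ys \<noteq> []"
    by auto
  then have hd: "hd ys \<in> V" "hd ys \<in> set ys"
    using ys(5) by auto
  have "inn E (hd ys) \<inter> (F \<union> set ys) \<subseteq> F \<union> (set ys - {hd ys})"
    using irrefl by auto
  then have "card (inn E (hd ys) \<inter> (F \<union> set ys)) \<le> card (F \<union> (set ys - {hd ys}))"
    using assms(3) by (intro card_mono) auto
  also have "\<dots> \<le> card F + card (set ys - {hd ys})"
    by (rule card_Un_le)
  also have "\<dots> < d"
    using Suc.prems ys hd by (simp add: distinct_card)
  also have "\<dots> \<le> card (inn E (hd ys))"
    by (rule indeg[OF hd(1)])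
  finally have "\<not> inn E (hd ys) \<subseteq> F \<union> set ys"
    by (metis inf.absorb_iff1 less_irrefl)
  then obtain x where x: "E x (hd ys)" "x \<notin> F" "x \<notin> set ys"
    unfolding subset_iff in_inn by blast
  then have "x \<in> V"
    using wf by blast
  with x show ?case
    using ys ne by (intro exI[of _ "x # ys"]) (simp add: successively_Cons)
qed

text \<open>In \<open>v \<rightarrow> a \<rightarrow> x\<close> and \<open>last ys \<rightarrow> b \<rightarrow> v\<close> the vertices \<open>a\<close> and \<open>b\<close> may be skipped, so three
  consecutive lengths of the connection from \<open>x\<close> to \<open>ys\<close> are equally good.\<close>

lemma assemble:
  assumes arcs: "E v a" "E v x" "E a x" "E (last ys) v" "E (last ys) b" "E b v"
    and ys: "ys \<noteq> []" "distinct ([v, a, x, b] @ ys)" "successively E ys"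
    and Z: "Z \<subseteq> outn E x" "Z \<inter> ({v, a, x, b} \<union> set ys) = {}"
    and W: "W \<subseteq> inn E (hd ys)" "W \<inter> ({v, a, x, b} \<union> set ys) = {}"
    and U: "U \<inter> ({v, x} \<union> set ys) = {}"
    and conn: "Z \<inter> W \<noteq> {} \<or> (\<exists>z\<in>Z. \<exists>w\<in>W. E z w) \<or> (\<exists>z\<in>Z. \<exists>p\<in>U. \<exists>w\<in>W. E z p \<and> E p w)"
  shows "on_cycle E (length ys + 5) v"
proof -
  have fZ: "z \<notin> {v, a, x, b} \<union> set ys" "E x z" if "z \<in> Z" for z
    using that Z by auto
  have fW: "w \<notin> {v, a, x, b} \<union> set ys" "E w (hd ys)" if "w \<in> W" for w
    using that W by auto
  have fU: "p \<notin> {v, x} \<union> set ys" if "p \<in> U" for p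
    using that U by auto
  show ?thesis
    using conn
  \<comment> \<open>The number of arcs of the connection and the number of optional vertices kept
    always add up to 2. A middle vertex \<open>p\<close> may coincide with \<open>a\<close> or
    \<open>b\<close>, but then both are skipped; hence \<open>U\<close> is allowed to contain
    them.\<close>
  proof (elim disjE bexE conjE)
    assume "Z \<inter> W \<noteq> {}"
    then obtain z where z: "z \<in> Z" "z \<in> W"
      by blast
    note f = fZ[OF z(1)] fW[OF z(2)]
    show ?thesis
      by (rule on_cycleI[of "[v, a, x, z] @ ys @ [b]"]) (use arcs ys f in \<open>auto simp: successively_append_iff successively_Cons\<close>)
  next
    fix z w assume z: "z \<in> Z" "w \<in> W" "E z w"
    then have "z \<noteq> w"
      using irrefl by auto
    note f = fZ[OF z(1)] fW[OF z(2)] z(3) this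
    show ?thesis
      by (rule on_cycleI[of "[v, a, x, z, w] @ ys"]) (use arcs ys f in \<open>auto simp: successively_append_iff successively_Cons\<close>)
  next
    fix z p w assume z: "z \<in> Z" "p \<in> U" "w \<in> W" "E z p" "E p w"
    then have "z \<noteq> p" "z \<noteq> w" "p \<noteq> w"
      using asym by blast+
    note f = fZ[OF z(1)] fU[OF z(2)] fW[OF z(3)] z(4,5) this
    show ?thesis
      by (rule on_cycleI[of "[v, x, z, p, w] @ ys"]) (use arcs ys f in \<open>auto simp: successively_append_iff successively_Cons\<close>)
  qed
qed

text \<open>The arc from \<open>s\<close> to \<open>x\<close> makes \<open>u\<close> a third
  optional vertex, so a connection with up to three arcs is acceptable: its arcs and the optional
  vertices kept add up to 3.\<close>

lemma assemble_long:
  assumes arcs: "E v a" "E v s" "E a s" "E s u" "E s x" "E u x" "E (last ys) v" "E (last ys) b" "E b v"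
    and ys: "ys \<noteq> []" "distinct ([v, a, s, u, x, b] @ ys)" "successively E ys"
    and Z: "Z \<subseteq> outn E x" "Z \<inter> ({v, a, s, u, x, b} \<union> set ys) = {}"
    and W: "W \<subseteq> inn E (hd ys)" "W \<inter> ({v, a, s, u, x, b} \<union> set ys) = {}"
    and U: "U \<inter> ({v, s, x} \<union> set ys) = {}"
    and conn: "Z \<inter> W \<noteq> {} \<or> (\<exists>z\<in>Z. \<exists>w\<in>W. E z w) \<or> (\<exists>z\<in>Z. \<exists>p\<in>U. \<exists>w\<in>W. E z p \<and> E p w) \<or>
      (\<exists>z\<in>Z. \<exists>p\<in>U. \<exists>p'\<in>U. \<exists>w\<in>W. E z p \<and> E p p' \<and> E p' w \<and> distinct [z, p, p', w])"
  shows "on_cycle E (length ys + 7) v"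
proof -
  have fZ: "z \<notin> {v, a, s, u, x, b} \<union> set ys" "E x z" if "z \<in> Z" for z
    using that Z by auto
  have fW: "w \<notin> {v, a, s, u, x, b} \<union> set ys" "E w (hd ys)" if "w \<in> W" for w
    using that W by auto
  have fU: "p \<notin> {v, s, x} \<union> set ys" if "p \<in> U" for p
    using that U by auto
  show ?thesis
    using conn
  proof (elim disjE bexE conjE)
    assume "Z \<inter> W \<noteq> {}"
    then obtain z where z: "z \<in> Z" "z \<in> W"
      by blast
    note f = fZ[OF z(1)] fW[OF z(2)]
    show ?thesis
      by (rule on_cycleI[of "[v, a, s, u, x, z] @ ys @ [b]"]) (use arcs ys f in \<open>auto simp: successively_append_iff successively_Cons\<close>)
  next
    fix z w assume z: "z \<in> Z" "w \<in> W" "E z w"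
    then have "z \<noteq> w"
      using irrefl by auto
    note f = fZ[OF z(1)] fW[OF z(2)] z(3) this
    show ?thesis
      by (rule on_cycleI[of "[v, a, s, u, x, z, w] @ ys"]) (use arcs ys f in \<open>auto simp: successively_append_iff successively_Cons\<close>)
  next
    fix z p w assume z: "z \<in> Z" "p \<in> U" "w \<in> W" "E z p" "E p w"
    then have "z \<noteq> p" "z \<noteq> w" "p \<noteq> w"
      using asym by blast+
    note f = fZ[OF z(1)] fU[OF z(2)] fW[OF z(3)] z(4,5) this
    show ?thesis
    \<comment> \<open>One optional vertex has to be kept, and \<open>p\<close> may itself be
      optional. So \<open>b\<close> is kept if \<open>p = a\<close>, and \<open>a\<close>
      otherwise.\<close>
    proof (cases "p = a")
      case True
      then have "p \<noteq> b"
        using ys(2) by auto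
      with True show ?thesis
        by (intro on_cycleI[of "[v, s, x, z, p, w] @ ys @ [b]"]) (use arcs ys f in \<open>auto simp: successively_append_iff successively_Cons\<close>)
    next
      case False
      then show ?thesis
        by (intro on_cycleI[of "[v, a, s, x, z, p, w] @ ys"]) (use arcs ys f in \<open>auto simp: successively_append_iff successively_Cons\<close>)
    qed
  next
    fix z p p' w assume z: "z \<in> Z" "p \<in> U" "p' \<in> U" "w \<in> W" "E z p" "E p p'" "E p' w"
      "distinct [z, p, p', w]"
    note f = fZ[OF z(1)] fU[OF z(2)] fU[OF z(3)] fW[OF z(4)] z(5-8)
    show ?thesis
      by (rule on_cycleI[of "[v, s, x, z, p, p', w] @ ys"]) (use arcs ys f in \<open>auto simp: successively_append_iff successively_Cons\<close>)
  qed
qed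

lemma card_inn_Diff:
  assumes "x \<in> V" "finite F" "card (inn E x \<inter> F) \<le> k"
  shows "d - k \<le> card (inn E x - F)"
  using semidegree_graph.card_outn_Diff[OF converse_graph assms(1,2)] assms(3) by simp

lemma card_inn_Diff':
  assumes "x \<in> V" "finite F"
  shows "d - card F \<le> card (inn E x \<inter> (V - F))"
  using semidegree_graph.card_outn_Diff'[OF converse_graph assms] by simp

lemma card_Diff_subset_V: "F \<subseteq> V \<Longrightarrow> card (V - F) + card F = card V"
  using finite_V by (simp add: card_Diff_subset card_mono finite_subset)

lemma asym_conversep: "E\<inverse>\<inverse> x y \<Longrightarrow> \<not> E\<inverse>\<inverse> y x"
  using asym by blast

text \<open>A path \<open>ys\<close> with \<open>3q - 5\<close> vertices ending in \<open>y\<close>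
  is reserved first. What remains is a connection of bounded length from the out-neighbours of
  \<open>s\<close> (or of \<open>x\<close>, when an arc \<open>u \<rightarrow> x\<close> lies in
  that neighbourhood) to the in-neighbours of the start of the path.\<close>

lemma on_cycle_if_arcs_at_both_ends:
  assumes q: "3 \<le> q" "15 * q \<le> d + 12"
    and arcs: "E v a" "E v s" "E a s" "E y v" "E b v" "E y b"
  shows "on_cycle E (3 * q) v"
proof -
  have V: "v \<in> V" "a \<in> V" "s \<in> V" "y \<in> V" "b \<in> V"
    using arcs wf by blast+
  have ne: "v \<noteq> a" "v \<noteq> s" "v \<noteq> b" "a \<noteq> s" "a \<noteq> b" "s \<noteq> b" "y \<notin> {v, a, s, b}"
    using arcs asym by blast+
  have "card {v, a, s, b} + (3 * q - 6) < d"
    using ne q by simp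
  then obtain ys where ys: "length ys = 3 * q - 6 + 1" "distinct ys" "successively E ys" "last ys = y"
    "set ys \<subseteq> V" "set ys \<inter> {v, a, s, b} = {}"
    using backward_path[OF V(4) ne(7)] by blast
  have len: "length ys + 5 = 3 * q"
    using ys(1) q by simp
  have ys_ne: "ys \<noteq> []"
    using ys(1) by auto
  have card_ys: "card (set ys) = length ys"
    using ys(2) by (rule distinct_card)
  have hd_ys: "hd ys \<in> V" "hd ys \<in> set ys"
    using ys(5) ys_ne by auto
  define F0 where "F0 = {v, a, s, b} \<union> set ys"
  show ?thesis
  proof (cases "\<exists>u x. u \<in> outn E s - F0 \<and> x \<in> outn E s - F0 \<and> E u x")
    case False
    define F where "F = {v, s} \<union> set ys"
    define U where "U = V - F"
    define m where "m = d - (length ys + 2)"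
    define Z where "Z = outn E s - F0"
    define W where "W = inn E (hd ys) - F0"
    have cF: "card F = length ys + 2" "finite F" "F \<subseteq> V"
      using card_ys ne ys V by (auto simp: F_def card_Un_disjoint)
    have fU: "finite U"
      using finite_V by (simp add: U_def)
    have ZU: "Z \<subseteq> U" "W \<subseteq> U"
      using outn_subset inn_subset by (auto simp: Z_def W_def U_def F_def F0_def)
    have degU: "m \<le> card (outn E x \<inter> U)" "m \<le> card (inn E x \<inter> U)" if "x \<in> U" for x
      using card_outn_Diff'[of x F] card_inn_Diff'[of x F] that cF by (auto simp: U_def m_def)
    have "outn E s \<inter> F0 \<subseteq> insert b (set ys)"
      using asym[OF arcs(2)] asym[OF arcs(3)] irrefl by (auto simp: F0_def)
    then have "card (outn E s \<inter> F0) \<le> card (insert b (set ys))"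
      by (rule card_mono[rotated]) simp
    also have "\<dots> \<le> length ys + 1"
      using card_ys by (simp add: card_insert_if)
    finally have cZ: "m + 1 \<le> card Z"
      using card_outn_Diff[OF V(3), of F0 "length ys + 1"] len q by (simp add: F0_def Z_def m_def)
    have "inn E (hd ys) \<inter> F0 \<subseteq> {v, a, s, b} \<union> (set ys - {hd ys})"
      using irrefl by (auto simp: F0_def)
    then have "card (inn E (hd ys) \<inter> F0) \<le> card ({v, a, s, b} \<union> (set ys - {hd ys}))"
      by (rule card_mono[rotated]) simp
    also have "\<dots> \<le> card {v, a, s, b} + card (set ys - {hd ys})"
      by (rule card_Un_le)
    also have "\<dots> = 4 + (length ys - 1)"
      using ne card_ys hd_ys by simp
    finally have cW: "m \<le> card W + 1"
      using card_inn_Diff[OF hd_ys(1), of F0 "4 + (length ys - 1)"] ys_ne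
      by (cases ys) (auto simp: F0_def W_def m_def)
    have "Z \<noteq> {}"
      using cZ by auto
    moreover have "W \<noteq> {}"
      using cW len q by (auto simp: m_def)
    ultimately have Z2: "card Z + m \<le> card (Z \<union> boundary E U Z)"
      and W2: "card W + 2 * m + 1 \<le> 2 * card (W \<union> boundary E\<inverse>\<inverse> U W)"
      by (intro two_levels_independent two_levels fU ZU asym_conversep;
          use False degU ZU in \<open>force simp: Z_def\<close>)+
    have "card U + card F = card V"
      using card_Diff_subset_V[OF cF(3)] by (simp add: U_def)
    \<comment> \<open>The two sides have at least \<open>7m/2 + 1\<close> vertices together, with
      \<open>m = d - 3q + 3\<close>, while \<open>U\<close> has at most \<open>3d - 3q + 3\<close>.
      The comparison amounts to \<open>d > 15q - 17\<close>.\<close>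
    then have "card U < card (Z \<union> boundary E U Z) + card (W \<union> boundary E\<inverse>\<inverse> U W)"
      using Z2 W2 cZ cW cF(1) card_V len q by (simp add: m_def)
    note conn = short_connection[OF fU ZU this]
    have "E (last ys) v" "E (last ys) b" "distinct ([v, a, s, b] @ ys)"
      using arcs ys ne by auto
    moreover have "Z \<subseteq> outn E s" "Z \<inter> ({v, a, s, b} \<union> set ys) = {}" "W \<subseteq> inn E (hd ys)"
      "W \<inter> ({v, a, s, b} \<union> set ys) = {}" "U \<inter> ({v, s} \<union> set ys) = {}"
      by (auto simp: Z_def W_def U_def F_def F0_def)
    ultimately have "on_cycle E (length ys + 5) v"
      by (intro assemble[OF arcs(1-3) _ _ arcs(5) ys_ne _ ys(3) _ _ _ _ _ conn])
    then show ?thesis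
      by (simp add: len)
  next
    case True
    then obtain u x where ux: "E s u" "E s x" "E u x" "u \<notin> F0" "x \<notin> F0"
      by auto
    have uxV: "u \<in> V" "x \<in> V" "u \<noteq> x"
      using ux wf irrefl by blast+
    \<comment> \<open>Two vertices of the reserved path are given up to make room for
      \<open>u\<close> and \<open>x\<close>. The end \<open>y\<close> is kept.\<close>
    define zs where "zs = drop 2 ys"
    have zs: "distinct zs" "successively E zs" "set zs \<subseteq> set ys" "length zs + 7 = 3 * q"
      using ys len q set_drop_subset[of 2 ys] successively_append_iff[of E "take 2 ys" "drop 2 ys"]
      by (auto simp: zs_def)
    have zs_ne: "zs \<noteq> []"
    proof
      assume "zs = []"
      then have "3 * q = 7"
        using zs(4) by simp
      then show False
        by presburger
    qed
    have last_zs: "last zs = y"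
      using ys zs_ne by (simp add: zs_def last_drop)
    have card_zs: "card (set zs) = length zs"
      using zs(1) by (rule distinct_card)
    have zs_disj: "set zs \<inter> {v, a, s, u, x, b} = {}"
      using zs(3) ys(6) ux by (auto simp: F0_def)
    have dist: "distinct ([v, a, s, u, x, b] @ zs)"
      using zs(1) zs_disj ne uxV ux by (auto simp: F0_def)
    have hd_zs: "hd zs \<in> V"
      using zs(3) ys(5) hd_in_set[OF zs_ne] by blast
    define F where "F = {v, s, x} \<union> set zs"
    define F1 where "F1 = {v, a, s, u, x, b} \<union> set zs"
    define U where "U = V - F"
    define m where "m = d - (length zs + 3)"
    define Z where "Z = outn E x - F1"
    define W where "W = inn E (hd zs) - F1"
    have cF: "card F = length zs + 3" "finite F" "F \<subseteq> V"
    proof -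
      have "F = set ([v, s, x] @ zs)" "distinct ([v, s, x] @ zs)"
        using dist by (auto simp: F_def)
      then show "card F = length zs + 3"
        using distinct_card[of "[v, s, x] @ zs"] by simp
    qed (use V uxV zs ys in \<open>auto simp: F_def\<close>)
    have cF1: "card F1 = length zs + 6" "finite F1"
    proof -
      have "F1 = set ([v, a, s, u, x, b] @ zs)"
        by (auto simp: F1_def)
      then show "card F1 = length zs + 6"
        using distinct_card[OF dist] by simp
    qed (simp add: F1_def)
    have fU: "finite U"
      using finite_V by (simp add: U_def)
    have ZU: "Z \<subseteq> U" "W \<subseteq> U"
      using outn_subset inn_subset by (auto simp: Z_def W_def U_def F_def F1_def)
    have degU: "m \<le> card (outn E x \<inter> U)" "m \<le> card (inn E x \<inter> U)" if "x \<in> U" for x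
      using card_outn_Diff'[of x F] card_inn_Diff'[of x F] that cF by (auto simp: U_def m_def)
    have "card (outn E x \<inter> F1) \<le> card F1" "card (inn E (hd zs) \<inter> F1) \<le> card F1"
      using cF1(2) by (auto intro: card_mono)
    then have cZ: "m \<le> card Z + 3" and cW: "m \<le> card W + 3"
      using card_outn_Diff[OF uxV(2) cF1(2), of "card F1"] card_inn_Diff[OF hd_zs cF1(2), of "card F1"]
      by (auto simp: Z_def W_def m_def cF1(1))
    have m7: "7 \<le> m"
      using zs(4) q by (simp add: m_def)
    have Z3: "2 * m \<le> card (Z \<union> boundary E U Z \<union> boundary E U (Z \<union> boundary E U Z))"
      by (rule three_levels[OF fU ZU(1) asym degU(1) cZ m7])
    have "W \<noteq> {}"
      using cW m7 by auto
    then have W2: "card W + 2 * m + 1 \<le> 2 * card (W \<union> boundary E\<inverse>\<inverse> U W)"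
      by (intro two_levels fU ZU asym_conversep) (use degU ZU in auto)
    have "card U + card F = card V"
      using card_Diff_subset_V[OF cF(3)] by (simp add: U_def)
    then have lt: "card U < card (Z \<union> boundary E U Z \<union> boundary E U (Z \<union> boundary E U Z)) + card (W \<union> boundary E\<inverse>\<inverse> U W)"
      using Z3 W2 cW cF(1) card_V zs(4) q by (simp add: m_def)
    have "E (last zs) v" "E (last zs) b"
      using arcs last_zs by auto
    moreover have "Z \<subseteq> outn E x" "Z \<inter> ({v, a, s, u, x, b} \<union> set zs) = {}" "W \<subseteq> inn E (hd zs)"
      "W \<inter> ({v, a, s, u, x, b} \<union> set zs) = {}" "U \<inter> ({v, s, x} \<union> set zs) = {}"
      by (auto simp: Z_def W_def U_def F_def F1_def)
    ultimately have "on_cycle E (length zs + 7) v"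
      by (intro assemble_long[OF arcs(1-3) ux(1-3) _ _ arcs(5) zs_ne dist zs(2) _ _ _ _ _
            long_connection[OF fU ZU asym lt]])
    then show ?thesis
      by (simp add: zs(4))
  qed
qed

section \<open>Cycles of length six through arcs in both neighbourhoods\<close>

text \<open>The smaller boundary, say \<open>Q\<close>, has at most \<open>(d + 1) / 2\<close> vertices but receives many arcs from
  \<open>Z\<close>; it cannot return them and sends nothing to \<open>W\<close>, so its outdegrees are too small.\<close>

lemma no_short_connection_unbalanced:
  assumes d: "10 \<le> d" and U: "U \<subseteq> V" "card U + 3 \<le> 3 * d"
    and Z: "Z \<subseteq> U" "card Z = d - 2" and W: "W \<subseteq> U" "card W = d - 2"
    and disj: "(Z \<union> boundary E U Z) \<inter> (W \<union> boundary E\<inverse>\<inverse> U W) = {}"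
    and degZ: "\<And>z. z \<in> Z \<Longrightarrow> d - 1 \<le> card (outn E z \<inter> U)"
    and degQ: "\<And>z. z \<in> boundary E U Z \<Longrightarrow> d - 2 \<le> card (outn E z \<inter> U)"
    and le: "card (boundary E U Z) \<le> card (boundary E\<inverse>\<inverse> U W)"
  shows False
proof -
  define Q where "Q = boundary E U Z"
  define R where "R = U - (Z \<union> Q \<union> W)"
  define k where "k = card Q"
  have fU: "finite U"
    using U(1) finite_V finite_subset by auto
  have sub: "Q \<subseteq> U" "R \<subseteq> U"
    by (auto simp: Q_def R_def boundary_def)
  then have fin: "finite Z" "finite W" "finite Q" "finite R"
    using fU Z(1) W(1) by (auto intro: finite_subset)
  have dj: "Z \<inter> Q = {}" "Z \<inter> W = {}" "Q \<inter> W = {}" "(Z \<union> Q) \<inter> R = {}" "Z \<inter> Q = {}"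
    using disj by (auto simp: Q_def R_def boundary_def)
  have UZQR: "U = Z \<union> Q \<union> R \<union> W"
    using sub Z(1) W(1) by (auto simp: R_def)
  have noW: "outn E x \<inter> W = {}" if "x \<in> Z \<union> Q" for x
  proof -
    have "x \<in> U"
      using that Z(1) sub by auto
    then show ?thesis
      using that disj unfolding Q_def boundary_def by (auto simp: disjoint_iff)
  qed
  have "card (Z \<union> Q) + card (W \<union> boundary E\<inverse>\<inverse> U W) = card ((Z \<union> Q) \<union> (W \<union> boundary E\<inverse>\<inverse> U W))"
    using disj fin fU by (intro card_Un_disjoint[symmetric]) (auto simp: Q_def finite_boundary)
  also have "\<dots> \<le> card U"
    using fU Z(1) W(1) sub boundary_subset[of "E\<inverse>\<inverse>" U W] by (intro card_mono) auto
  finally have "card Z + k + (card W + card (boundary E\<inverse>\<inverse> U W)) \<le> card U"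
    using card_Un_boundary[OF fU Z(1), of E] card_Un_boundary[OF fU W(1), of "E\<inverse>\<inverse>"] by (simp add: Q_def k_def)
  \<comment> \<open>Both sides fit disjointly into \<open>U\<close>, so the two boundaries have at
    most \<open>3d - 3 - 2 (d - 2) = d + 1\<close> vertices together, and \<open>Q\<close> is the
    smaller one.\<close>
  then have k: "2 * k \<le> d + 1"
    using le U(2) Z(2) W(2) d by (simp add: k_def Q_def)
  have eqZ: "outn E z \<inter> U = outn E z \<inter> (Z \<union> Q)" if "z \<in> Z" for z
    using that Z(1) sub unfolding Q_def boundary_def by auto
  have "card Z * (d - 1) \<le> arc_count E Z (Z \<union> Q)"
    using degZ fin by (intro arc_count_ge) (simp_all add: eqZ[symmetric])
  then have 1: "card Z * (d - 1) \<le> arc_count E Z Z + arc_count E Z Q"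
    using fin dj by (simp add: arc_count_Un_right)
  have 2: "2 * arc_count E Z Z + card Z \<le> card Z * card Z"
    using fin by (intro arc_count_self asym)
  have eqQ: "outn E z \<inter> U = outn E z \<inter> (Z \<union> Q \<union> R)" if "z \<in> Q" for z
    using noW[of z] that UZQR by auto
  have "card Q * (d - 2) \<le> arc_count E Q (Z \<union> Q \<union> R)"
    using degQ[folded Q_def] fin by (intro arc_count_ge) (simp_all add: eqQ[symmetric])
  also have "\<dots> = arc_count E Q Z + arc_count E Q Q + arc_count E Q R"
    using fin dj by (simp add: arc_count_Un_right)
  finally have 3: "k * (d - 2) \<le> arc_count E Q Z + arc_count E Q Q + k * card R"
    using arc_count_le_card[OF fin(4), of E Q] by (simp add: k_def)
  have 4: "2 * arc_count E Q Q + k \<le> k * k"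
    unfolding k_def using fin by (intro arc_count_self asym)
  have 5: "arc_count E Z Q + arc_count E Q Z \<le> card Z * k"
    unfolding k_def using fin by (intro arc_count_antiparallel asym)
  have "card U = card Z + k + card R + card W"
  proof -
    have "(Z \<union> Q \<union> R) \<inter> W = {}"
      using dj by (auto simp: R_def)
    then show ?thesis
      using fin dj unfolding UZQR k_def by (simp add: card_Un_disjoint)
  qed
  then have cR: "card R + k \<le> d + 1"
    using U(2) Z(2) W(2) d by simp
  define c where "c = d - 2"
  have c: "d = c + 2"
    using d by (simp add: c_def)
  define eZZ eZQ eQZ eQQ r where "eZZ = int (arc_count E Z Z)" "eZQ = int (arc_count E Z Q)"
    "eQZ = int (arc_count E Q Z)" "eQQ = int (arc_count E Q Q)" "r = int (card R)"
  have cZ: "card Z = c"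
    using Z(2) c by simp
  have i1: "int c * (int c + 1) \<le> eZZ + eZQ"
    using of_nat_mono[OF 1, where 'a = int] unfolding cZ c eZZ_eZQ_eQZ_eQQ_r_def by (simp add: algebra_simps)
  have i2: "2 * eZZ + int c \<le> int c * int c"
    using of_nat_mono[OF 2, where 'a = int] unfolding cZ c eZZ_eZQ_eQZ_eQQ_r_def by (simp add: algebra_simps)
  have i3: "int k * int c \<le> eQZ + eQQ + int k * r"
    using of_nat_mono[OF 3, where 'a = int] unfolding c eZZ_eZQ_eQZ_eQQ_r_def by (simp add: algebra_simps)
  have i4: "2 * eQQ + int k \<le> int k * int k"
    using of_nat_mono[OF 4, where 'a = int] unfolding c eZZ_eZQ_eQZ_eQQ_r_def by (simp add: algebra_simps)
  have i5: "eZQ + eQZ \<le> int c * int k"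
    using of_nat_mono[OF 5, where 'a = int] unfolding cZ c eZZ_eZQ_eQZ_eQQ_r_def by (simp add: algebra_simps)
  have i6: "r \<le> int c + 3 - int k"
    using cR c unfolding eZZ_eZQ_eQZ_eQQ_r_def by simp
  have "int k * r \<le> int k * (int c + 3 - int k)"
    using i6 by (intro mult_left_mono) auto
  \<comment> \<open>The bounds \<open>i1\<close> and \<open>i2\<close> force many arcs from
    \<open>Z\<close> to \<open>Q\<close>, \<open>i5\<close> then leaves few back, and
    \<open>i3\<close> and \<open>i4\<close> bound what \<open>Q\<close> needs. All arc counts
    cancel.\<close>
  then have "2 * (int c * (int c + 1)) + int c - int c * int c
      \<le> 2 * (int c * int k) + int k * int k - int k + 2 * (int k * (int c + 3 - int k)) - 2 * (int k * int c)"
    using i1 i2 i3 i4 i5 by linarith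
  then have "int c * (int c + 3) \<le> int k * (2 * int c + 5 - int k)"
    by (simp add: algebra_simps)
  moreover have "k \<le> 2 * c + 5"
    using k c by simp
  moreover from this have "int (c * (c + 3)) = int c * (int c + 3)"
    "int (k * (2 * c + 5 - k)) = int k * (2 * int c + 5 - int k)"
    unfolding of_nat_mult by (simp_all add: of_nat_diff)
  ultimately have "int (c * (c + 3)) \<le> int (k * (2 * c + 5 - k))"
    by (simp only:)
  then have "c * (c + 3) \<le> k * (2 * c + 5 - k)"
    by (simp only: of_nat_le_iff)
  then have "(d - 2) * (d + 1) \<le> k * (2 * d + 1 - k)"
    using c by (simp add: numeral_eq_Suc)
  from quadratic_window_bound[OF d k this] show False .
qed

text \<open>It remains to supply the degrees inside \<open>U\<close>. A vertex of \<open>Z\<close>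
  can lose only \<open>v\<close>. A vertex of the boundary other than \<open>a\<close> has no arc to
  \<open>y\<close>, since otherwise it would lie in \<open>W0\<close> and receive an arc from
  \<open>Z0\<close>; and \<open>a\<close> has no arc to \<open>v\<close>. So every boundary vertex
  loses at most two.\<close>

lemma no_connection_unbalanced:
  assumes d: "10 \<le> d" and arcs: "E v a" "E v s" "E a s" "E y v" "E b v" "E y b"
    and U: "U = V - {v, s, y}"
    and Z0: "Z0 = outn E s - {v, a, s, b, y}" and W0: "W0 = inn E y - {v, a, s, b, y}"
    and ZW: "Z \<subseteq> Z0" "card Z = d - 2" "W \<subseteq> W0" "card W = d - 2"
    and no_conn: "Z0 \<inter> W0 = {}" "\<And>z w. z \<in> Z0 \<Longrightarrow> w \<in> W0 \<Longrightarrow> \<not> E z w"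
      "\<And>z p w. z \<in> Z0 \<Longrightarrow> p \<in> U \<Longrightarrow> w \<in> W0 \<Longrightarrow> E z p \<Longrightarrow> \<not> E p w"
    and le: "card (boundary E U Z) \<le> card (boundary E\<inverse>\<inverse> U W)"
  shows False
proof (rule no_short_connection_unbalanced[OF d _ _ _ ZW(2) _ ZW(4) _ _ _ le])
  have V: "v \<in> V" "s \<in> V" "y \<in> V" "{v, s, y} \<subseteq> V"
    using wf arcs by auto
  have "v \<noteq> s" "v \<noteq> y" "s \<noteq> y"
    using arcs asym by blast+
  then have ne: "card {v, s, y} = 3"
    by simp
  show "U \<subseteq> V" "card U + 3 \<le> 3 * d"
    using card_V card_Diff_subset_V[OF V(4)] ne by (auto simp: U)
  show ZU: "Z \<subseteq> U" "W \<subseteq> U"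
    using ZW Z0 W0 outn_subset[of s] inn_subset[of y] unfolding U by blast+
  show "(Z \<union> boundary E U Z) \<inter> (W \<union> boundary E\<inverse>\<inverse> U W) = {}"
    using no_conn ZW(1,3) unfolding boundary_def by blast
  have deg: "d - card S \<le> card (outn E x \<inter> U)" if "x \<in> V" "outn E x \<inter> {v, s, y} \<subseteq> S" "finite S" for x S
  proof -
    have "outn E x \<inter> U = outn E x - {v, s, y}"
      using outn_subset[of x] by (auto simp: U)
    then show ?thesis
      using card_outn_Diff[OF that(1), of "{v, s, y}" "card S"] that by (simp add: card_mono)
  qed
  fix x
  show "d - 1 \<le> card (outn E x \<inter> U)" if x: "x \<in> Z"
  proof -
    have "x \<in> Z0" "E s x"
      using x ZW(1) by (auto simp: Z0)
    moreover from this have "\<not> E x s"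
      using asym by blast
    moreover have "\<not> E x y"
      using no_conn(1) \<open>x \<in> Z0\<close> unfolding Z0 W0 by auto
    ultimately have "outn E x \<inter> {v, s, y} \<subseteq> {v}"
      by auto
    moreover have "x \<in> V"
      using x ZU(1) U by blast
    ultimately show ?thesis
      using deg[of x "{v}"] by simp
  qed
  show "d - 2 \<le> card (outn E x \<inter> U)" if x: "x \<in> boundary E U Z"
  proof -
    obtain z where z: "z \<in> Z0" "E z x" "x \<in> U"
      using x ZW(1) unfolding boundary_def by blast
    have xy: "x = a" if "E x y"
    proof (rule ccontr)
      assume "x \<noteq> a"
      moreover have "x \<noteq> b"
        using asym[OF arcs(6)] that by auto
      ultimately have "x \<in> W0"
        using that z(3) U W0 by auto
      then show False
        using no_conn(2)[OF z(1)] z(2) by blast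
    qed
    show ?thesis
    proof (cases "x = a")
      case True
      then have "outn E x \<inter> {v, s, y} \<subseteq> {s, y}"
        using asym[OF arcs(1)] by auto
      then show ?thesis
        using deg[of x "{s, y}"] z(3) U \<open>s \<noteq> y\<close> by simp
    next
      case False
      then have "outn E x \<inter> {v, s, y} \<subseteq> {v, s}"
        using xy by auto
      then show ?thesis
        using deg[of x "{v, s}"] z(3) U \<open>v \<noteq> s\<close> by simp
    qed
  qed
qed

text \<open>The reserved path is the single vertex \<open>y\<close>. Both ends are trimmed to
  exactly \<open>d - 2\<close> vertices, and reversal of arcs covers the case in which the boundary
  of \<open>W\<close> is the smaller one.\<close>

lemma on_cycle_6_if_arcs_at_both_ends:
  assumes d: "10 \<le> d" and arcs: "E v a" "E v s" "E a s" "E y v" "E b v" "E y b"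
  shows "on_cycle E 6 v"
proof (rule ccontr)
  assume no: "\<not> on_cycle E 6 v"
  have V: "s \<in> V" "y \<in> V"
    using wf arcs by auto
  have ne: "distinct [v, a, s, b, y]"
    using asym[OF arcs(1)] asym[OF arcs(2)] asym[OF arcs(6)] arcs irrefl by auto
  define U where "U = V - {v, s, y}"
  define F where "F = {v, a, s, b, y}"
  define Z0 where "Z0 = outn E s - F"
  define W0 where "W0 = inn E y - F"
  have "\<not> (Z0 \<inter> W0 \<noteq> {} \<or> (\<exists>z\<in>Z0. \<exists>w\<in>W0. E z w) \<or> (\<exists>z\<in>Z0. \<exists>p\<in>U. \<exists>w\<in>W0. E z p \<and> E p w))"
  proof
    assume conn: "Z0 \<inter> W0 \<noteq> {} \<or> (\<exists>z\<in>Z0. \<exists>w\<in>W0. E z w) \<or> (\<exists>z\<in>Z0. \<exists>p\<in>U. \<exists>w\<in>W0. E z p \<and> E p w)"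
    have "on_cycle E (length [y] + 5) v"
      by (rule assemble[OF arcs(1-3) _ _ arcs(5) _ _ _ _ _ _ _ _ conn])
        (use ne arcs in \<open>auto simp: Z0_def W0_def U_def F_def\<close>)
    with no show False
      by simp
  qed
  then have no_conn: "Z0 \<inter> W0 = {}" "\<And>z w. z \<in> Z0 \<Longrightarrow> w \<in> W0 \<Longrightarrow> \<not> E z w"
    "\<And>z p w. z \<in> Z0 \<Longrightarrow> p \<in> U \<Longrightarrow> w \<in> W0 \<Longrightarrow> E z p \<Longrightarrow> \<not> E p w"
    by blast+
  have "outn E s \<inter> F \<subseteq> {b, y}" "inn E y \<inter> F \<subseteq> {a, s}"
    using asym[OF arcs(2)] asym[OF arcs(3)] asym[OF arcs(4)] asym[OF arcs(6)] irrefl by (auto simp: F_def)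
  then have "card (outn E s \<inter> F) \<le> card {b, y}" "card (inn E y \<inter> F) \<le> card {a, s}"
    by (auto intro: card_mono)
  then have "d - 2 \<le> card Z0" "d - 2 \<le> card W0"
    using card_outn_Diff[OF V(1), of F 2] card_inn_Diff[OF V(2), of F 2] ne
    by (auto simp: Z0_def W0_def F_def)
  then obtain Z W where ZW: "Z \<subseteq> Z0" "card Z = d - 2" "W \<subseteq> W0" "card W = d - 2"
    by (meson obtain_subset_with_card_n)
  note defs = U_def Z0_def[unfolded F_def] W0_def[unfolded F_def]
  show False
  proof (cases "card (boundary E U Z) \<le> card (boundary E\<inverse>\<inverse> U W)")
    case True
    show False
      by (rule no_connection_unbalanced[OF d arcs defs ZW no_conn True])
  next
    case False
    interpret conv: semidegree_graph V "E\<inverse>\<inverse>" d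
      by (rule converse_graph)
    show False
    proof (rule conv.no_connection_unbalanced[OF d, of v b y s a U W0 Z0 W Z])
      show "U = V - {v, y, s}" "W0 = outn E\<inverse>\<inverse> y - {v, b, y, a, s}" "Z0 = inn E\<inverse>\<inverse> s - {v, b, y, a, s}"
        using defs by auto
      show "W0 \<inter> Z0 = {}"
        using no_conn(1) by blast
    qed (use arcs ZW no_conn False in auto)
  qed
qed

end

section \<open>Independent out-neighbourhood: the equality structure\<close>

text \<open>Here \<open>\<sigma>\<close> and \<open>\<mu>\<close> stand for the numbers of vertices with \<open>\<iota> \<le> h\<close> and with \<open>h < \<iota> < h + q\<close>, see
  \<open>ex_crossing_arc\<close> below.\<close>

lemma crossing_bound:
  fixes q h d \<sigma> \<mu> :: nat
  assumes q: "3 \<le> q" "15 * q \<le> d + 12" and h: "h = (3 * q - 3) div 2"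
    and \<sigma>: "d \<le> \<sigma> + (3 * q - 3 - h)"
    and weight: "\<sigma> * (d - h) + \<mu> * (d - (h + q) + 1) \<le> d * d"
    and deg: "2 * (d - h) + 6 \<le> \<sigma> + 2 * \<mu> + 4 * q"
  shows False
proof -
  define D H Q S M where "D = int d - int h" and "H = int h" and "Q = int q" and "S = int \<sigma>"
    and "M = int \<mu>"
  have h2: "2 * h \<le> 3 * q - 3" "3 * q \<le> 2 * h + 4"
    using q(1) unfolding h by linarith+
  have H: "0 \<le> H" "2 * H \<le> 3 * Q - 3" "3 * Q \<le> 2 * H + 4" and Q: "3 \<le> Q"
    using h2 q by (auto simp: H_def Q_def)
  have hd: "h + q \<le> d"
    using h2 q by linarith
  have D: "13 * Q \<le> D + 9" "H + D = int d"
    using q h2 by (auto simp: D_def Q_def H_def)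
  have S: "D + 2 * H - 3 * Q + 3 \<le> S"
    using \<sigma> h2 q by (auto simp: D_def S_def H_def Q_def)
  have "int (\<sigma> * (d - h) + \<mu> * (d - (h + q) + 1)) \<le> int (d * d)"
    using weight by (simp only: of_nat_le_iff)
  then have w: "S * D + M * (D - Q + 1) \<le> (H + D) * (H + D)"
    using hd unfolding D_def H_def Q_def S_def M_def of_nat_add of_nat_mult
    by (simp add: of_nat_diff algebra_simps)
  have dg: "2 * D + 6 \<le> S + 2 * M + 4 * Q"
    using deg hd by (auto simp: D_def S_def M_def Q_def)
  have HH: "4 * (H * H) \<le> (3 * Q - 3) * (3 * Q - 3)"
    using mult_mono[of "2 * H" "3 * Q - 3" "2 * H" "3 * Q - 3"] H by simp
  \<comment> \<open>Were \<open>M\<close> larger, its weight on top of the lower bound for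
    \<open>S\<close> would exceed \<open>d * d\<close>.\<close>
  have M: "M \<le> 4 * Q"
  proof (rule ccontr)
    assume "\<not> M \<le> 4 * Q"
    then have "(4 * Q + 1) * (D - Q + 1) \<le> M * (D - Q + 1)"
      using D Q by (intro mult_right_mono) auto
    moreover have "(D + 2 * H - 3 * Q + 3) * D \<le> S * D"
      using S D Q by (intro mult_right_mono) auto
    ultimately have "(Q + 4) * D \<le> (4 * Q + 1) * (Q - 1) + H * H"
      using w by (simp add: algebra_simps)
    moreover have "(Q + 4) * (13 * Q - 9) \<le> (Q + 4) * D"
      using D Q by (intro mult_left_mono) auto
    ultimately have "4 * ((Q + 4) * (13 * Q - 9)) \<le> 4 * ((4 * Q + 1) * (Q - 1)) + (3 * Q - 3) * (3 * Q - 3)"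
      using HH by linarith
    then have "27 * (Q * Q) + 202 * Q \<le> 149"
      by (simp add: algebra_simps)
    moreover have "0 \<le> Q * Q"
      by simp
    ultimately show False
      using Q by linarith
  qed
  \<comment> \<open>With \<open>M\<close> this small, the degree condition makes \<open>S\<close>
    nearly \<open>2D\<close>, so that its weight alone is too large.\<close>
  have "(2 * D + 6 - 4 * Q - 2 * M) * D \<le> S * D"
    using dg D Q by (intro mult_right_mono) auto
  then have "D * D + (6 - 4 * Q - 2 * H) * D \<le> M * (D + Q - 1) + H * H"
    using w by (simp add: algebra_simps)
  also have "M * (D + Q - 1) \<le> 4 * Q * (D + Q - 1)"
    using M D Q by (intro mult_right_mono) auto
  finally have "(D - 8 * Q - 2 * H + 6) * D \<le> 4 * Q * (Q - 1) + H * H"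
    by (simp add: algebra_simps)
  moreover have "(2 * Q) * D \<le> (D - 8 * Q - 2 * H + 6) * D"
    using D H Q by (intro mult_right_mono) auto
  moreover have "(2 * Q) * (13 * Q - 9) \<le> (2 * Q) * D"
    using D Q by (intro mult_left_mono) auto
  ultimately have "4 * ((2 * Q) * (13 * Q - 9)) \<le> 4 * (4 * Q * (Q - 1)) + (3 * Q - 3) * (3 * Q - 3)"
    using HH by linarith
  then have "79 * (Q * Q) \<le> 38 * Q + 9"
    by (simp add: algebra_simps)
  moreover have "3 * Q \<le> Q * Q"
    using Q by (intro mult_right_mono) auto
  ultimately show False
    using Q by linarith
qed

locale independent_outn_graph = semidegree_graph +
  fixes v :: 'a
  assumes v: "v \<in> V"
    and d_pos: "0 < d"
    and independent: "E v x \<Longrightarrow> E v y \<Longrightarrow> \<not> E x y"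
begin

definition A :: "'a set" where "A = outn E v"
definition U :: "'a set" where "U = V - A"
text \<open>The parameter that controls the construction: it counts the ways to step back from
  \<open>u\<close> into \<open>A\<close>, and \<open>d - \<iota> u\<close> turns out to be the
  number of out-neighbours of \<open>u\<close> in \<open>A\<close>.\<close>

definition \<iota> :: "'a \<Rightarrow> nat" where "\<iota> u = card (inn E u \<inter> A)"

lemma A_subset: "A \<subseteq> V"
  unfolding A_def by (rule outn_subset)

lemma finite_A: "finite A" and finite_U: "finite U"
  using finite_V by (auto simp: U_def A_def finite_outn)

lemma A_Un_U: "V = A \<union> U" and A_Int_U: "A \<inter> U = {}"
  using A_subset by (auto simp: U_def)

lemma nbrs_A_subset:
  assumes "a \<in> A"
  shows "outn E a \<subseteq> U" "inn E a \<subseteq> U"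
proof -
  have "E v a"
    using assms by (simp add: A_def)
  then have "outn E a \<inter> A = {}" "inn E a \<inter> A = {}"
    using independent by (auto simp: A_def)
  then show "outn E a \<subseteq> U" "inn E a \<subseteq> U"
    using outn_subset[of a] inn_subset[of a] by (auto simp: U_def)
qed

lemma outn_Int_inn: "outn E x \<inter> inn E x = {}"
  using asym unfolding outn_def inn_def by blast

text \<open>A vertex of \<open>A\<close> has its at least \<open>2d\<close> neighbours in
  \<open>U\<close>, and \<open>A\<close> has at least \<open>d\<close> elements; as there are at
  most \<open>3d\<close> vertices, equality holds throughout.\<close>

lemma card_A: "card A = d" and card_U: "card U = 2 * d"
  and nbrs_A: "a \<in> A \<Longrightarrow> outn E a \<union> inn E a = U"
  and card_outn_A: "a \<in> A \<Longrightarrow> card (outn E a) = d"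
  and card_inn_A: "a \<in> A \<Longrightarrow> card (inn E a) = d"
proof -
  have ge: "d \<le> card A"
    using outdeg[OF v] by (simp add: A_def)
  have VA: "card U + card A = card V"
    using card_Un_disjoint[OF finite_A finite_U A_Int_U] A_Un_U by simp
  have *: "card (outn E a \<union> inn E a) = card (outn E a) + card (inn E a)"
    "card (outn E a \<union> inn E a) \<le> card U" "d \<le> card (outn E a)" "d \<le> card (inn E a)"
    "outn E a \<union> inn E a \<subseteq> U" if "a \<in> A" for a
  proof -
    show "card (outn E a \<union> inn E a) = card (outn E a) + card (inn E a)"
      by (rule card_Un_disjoint[OF finite_outn finite_inn outn_Int_inn])
    show "outn E a \<union> inn E a \<subseteq> U"
      using nbrs_A_subset[OF that] by simp
    then show "card (outn E a \<union> inn E a) \<le> card U"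
      by (rule card_mono[OF finite_U])
    have "a \<in> V"
      using that A_subset by blast
    then show "d \<le> card (outn E a)" "d \<le> card (inn E a)"
      by (rule outdeg indeg)+
  qed
  have "A \<noteq> {}"
    using ge d_pos by auto
  then obtain a0 where a0: "a0 \<in> A"
    by blast
  show cA: "card A = d" and cU: "card U = 2 * d"
    using *(1-4)[OF a0] ge VA card_V by linarith+
  assume a: "a \<in> A"
  show "card (outn E a) = d" "card (inn E a) = d"
    using *(1-4)[OF a] cU by linarith+
  show "outn E a \<union> inn E a = U"
    using *[OF a] cU by (intro card_subset_eq[OF finite_U]) linarith+
qed

lemma v_in_U: "v \<in> U" and \<iota>_v: "\<iota> v = 0"
proof -
  show "v \<in> U"
    using v irrefl by (simp add: U_def A_def)
  have "inn E v \<inter> A = {}"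
    using outn_Int_inn[of v] by (auto simp: A_def)
  then show "\<iota> v = 0"
    by (simp add: \<iota>_def)
qed

lemma card_outn_Int_A:
  assumes "u \<in> U"
  shows "card (outn E u \<inter> A) + \<iota> u = d"
proof -
  have "a \<in> outn E u \<union> inn E u" if "a \<in> A" for a
    using nbrs_A[OF that] assms by auto
  then have "A = (outn E u \<inter> A) \<union> (inn E u \<inter> A)"
    by blast
  then have "card A = card (outn E u \<inter> A) + card (inn E u \<inter> A)"
    using outn_Int_inn[of u] finite_A by (subst card_Un_disjoint[symmetric]) auto
  then show ?thesis
    by (simp add: card_A \<iota>_def)
qed

lemma outdeg_U:
  assumes "u \<in> U"
  shows "\<iota> u \<le> card (outn E u \<inter> U)"
proof -
  have "outn E u = (outn E u \<inter> A) \<union> (outn E u \<inter> U)"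
    using outn_subset[of u] A_Un_U by auto
  then have "card (outn E u) \<le> card (outn E u \<inter> A) + card (outn E u \<inter> U)"
    by (metis card_Un_le)
  moreover have "d \<le> card (outn E u)"
    using assms by (intro outdeg) (simp add: U_def)
  ultimately show ?thesis
    using card_outn_Int_A[OF assms] by linarith
qed

lemma indeg_U:
  assumes "u \<in> U"
  shows "d \<le> \<iota> u + card (inn E u \<inter> U)"
proof -
  have "inn E u = (inn E u \<inter> A) \<union> (inn E u \<inter> U)"
    using inn_subset[of u] A_Un_U by auto
  then have "card (inn E u) \<le> card (inn E u \<inter> A) + card (inn E u \<inter> U)"
    by (metis card_Un_le)
  moreover have "d \<le> card (inn E u)"
    using assms by (intro indeg) (simp add: U_def)
  ultimately show ?thesis
    by (simp add: \<iota>_def)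
qed

text \<open>Both sides count the arcs from \<open>A\<close> to \<open>U\<close>, of which each
  vertex of \<open>A\<close> sends \<open>d\<close>.\<close>

lemma sum_\<iota>: "(\<Sum>u\<in>U. \<iota> u) = d * d"
proof -
  have "(\<Sum>u\<in>U. \<iota> u) = arc_count E\<inverse>\<inverse> U A"
    by (simp add: arc_count_def \<iota>_def)
  also have "\<dots> = arc_count E A U"
    by (rule arc_count_conversep[OF finite_A finite_U])
  also have "\<dots> = (\<Sum>a\<in>A. d)"
    unfolding arc_count_def using nbrs_A_subset card_outn_A
    by (intro sum.cong refl) (simp add: Int_absorb2)
  finally show ?thesis
    by (simp add: card_A)
qed

text \<open>The out-neighbours of \<open>a\<close> and the in-neighbours of \<open>v\<close> are two
  sets of at least \<open>d\<close> vertices among the \<open>2d - 1\<close> vertices of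
  \<open>U - {v}\<close>.\<close>

lemma ex_outn_inn_v:
  assumes "a \<in> A"
  shows "\<exists>b. E a b \<and> E b v"
proof (rule ccontr)
  assume no: "\<not> ?thesis"
  have "E v a"
    using assms by (simp add: A_def)
  then have "v \<notin> outn E a"
    using asym by auto
  moreover have "inn E v \<subseteq> U - {v}"
    using inn_subset[of v] outn_Int_inn[of v] irrefl by (auto simp: U_def A_def)
  ultimately have "outn E a \<union> inn E v \<subseteq> U - {v}"
    using nbrs_A_subset[OF assms] by blast
  then have "card (outn E a \<union> inn E v) \<le> card (U - {v})"
    by (intro card_mono) (simp_all add: finite_U)
  moreover have "card (outn E a \<union> inn E v) = card (outn E a) + card (inn E v)"
    using no by (intro card_Un_disjoint finite_outn finite_inn) auto
  ultimately show False
    using card_outn_A[OF assms] indeg[OF v] v_in_U d_pos by (simp add: card_U)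
qed

section \<open>Chains and their initial pieces\<close>

text \<open>A chain, prefixed by \<open>v\<close> and a further vertex of \<open>A\<close>, closes to a cycle.\<close>

definition chain :: "'a list \<Rightarrow> bool" where
  "chain xs \<longleftrightarrow> xs \<noteq> [] \<and> distinct xs \<and> successively E xs \<and> set xs \<subseteq> V - {v} \<and>
     E (last xs) v \<and> hd xs \<in> U"

text \<open>The condition on \<open>\<iota>\<close> provides a predecessor of the head in
  \<open>A\<close> that is not yet on the chain.\<close>

lemma on_cycle_if_chain:
  assumes "chain xs" "card (set xs \<inter> A) < \<iota> (hd xs)"
  shows "on_cycle E (length xs + 2) v"
proof -
  have "\<not> inn E (hd xs) \<inter> A \<subseteq> set xs \<inter> A"
    using assms(2) card_mono[of "set xs \<inter> A" "inn E (hd xs) \<inter> A"] by (auto simp: \<iota>_def)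
  then obtain a where "E a (hd xs)" "a \<in> A" "a \<notin> set xs"
    unfolding inn_def by blast
  moreover from this have "E v a" "a \<noteq> v"
    using irrefl by (auto simp: A_def)
  ultimately show ?thesis
    using assms(1) by (intro on_cycleI[of "v # a # xs"]) (auto simp: chain_def successively_Cons)
qed

lemma chain_count: "chain xs \<Longrightarrow> card (set xs \<inter> A) + card (set xs \<inter> U) = length xs"
proof -
  assume "chain xs"
  then have "distinct xs" "set xs \<subseteq> V"
    by (auto simp: chain_def)
  then have "length xs = card ((set xs \<inter> A) \<union> (set xs \<inter> U))"
    using A_Un_U by (metis Int_Un_distrib distinct_card inf.absorb1)
  also have "\<dots> = card (set xs \<inter> A) + card (set xs \<inter> U)"
    using A_Int_U by (intro card_Un_disjoint) auto
  finally show ?thesis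
    by simp
qed

lemma chain_4:
  assumes "E x y" "E y a" "E a b" "E b v" "x \<in> U - {v}" "y \<in> U - {v}" "a \<in> A" "b \<noteq> x"
  shows "chain [x, y, a, b]" "card (set [x, y, a, b] \<inter> A) = 1"
proof -
  have "b \<in> U"
    using nbrs_A_subset[OF assms(7)] assms(3) by auto
  moreover have "b \<noteq> y" "b \<noteq> v" "x \<noteq> y" "a \<noteq> v"
    using assms asym v_in_U A_Int_U by blast+
  moreover have "a \<notin> U" "x \<notin> A" "y \<notin> A" "b \<notin> A"
    using assms \<open>b \<in> U\<close> A_Int_U by auto
  ultimately show "chain [x, y, a, b]" "card (set [x, y, a, b] \<inter> A) = 1"
    using assms A_Un_U by (auto simp: chain_def)
qed

text \<open>Without such a chain \<open>x, y, a, b\<close>, the vertices with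
  \<open>\<iota> > h\<close> send few arcs into \<open>U\<close>. But their outdegree in
  \<open>U\<close> is at least \<open>\<iota>\<close>, and the sum of \<open>\<iota>\<close> is
  \<open>d * d\<close>.\<close>

lemma ex_chain_4:
  assumes h: "8 + 2 * h < d"
  shows "\<exists>xs. chain xs \<and> length xs = 4 \<and> card (set xs \<inter> A) = 1 \<and> h < \<iota> (hd xs)"
proof (rule ccontr)
  assume no: "\<not> ?thesis"
  define X where "X = {x \<in> U - {v}. h < \<iota> x}"
  define T where "T = {u \<in> U. outn E u \<inter> A = {}}"
  define Y where "Y = U - {v} - T"
  have sub: "X \<subseteq> U" "T \<subseteq> U" "Y \<subseteq> U"
    by (auto simp: X_def Y_def T_def)
  then have fin: "finite X" "finite T" "finite Y"
    using finite_U by (auto intro: finite_subset)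
  have \<iota>_T: "\<iota> u = d" if "u \<in> T" for u
    using card_outn_Int_A[of u] that by (simp add: T_def)
  have v_T: "v \<notin> T"
    using \<iota>_T[of v] \<iota>_v d_pos by auto
  have TX: "T \<subseteq> X"
  proof
    fix u assume "u \<in> T"
    then show "u \<in> X"
      using \<iota>_T[of u] v_T sub h by (auto simp: X_def)
  qed
  \<comment> \<open>After fixing \<open>y \<rightarrow> a \<rightarrow> b \<rightarrow> v\<close>,
    every in-neighbour of \<open>y\<close> in \<open>X\<close> other than \<open>b\<close> would
    start a forbidden chain.\<close>
  have inX: "card (inn E y \<inter> X) \<le> 1" if "y \<in> Y" for y
  proof -
    have "outn E y \<inter> A \<noteq> {}"
      using that by (auto simp: Y_def T_def)
    then obtain a where a: "a \<in> A" "E y a"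
      by auto
    obtain b where b: "E a b" "E b v"
      using ex_outn_inn_v[OF a(1)] by blast
    have "inn E y \<inter> X \<subseteq> {b}"
    proof
      fix x assume "x \<in> inn E y \<inter> X"
      then have x: "E x y" "x \<in> U - {v}" "h < \<iota> x"
        by (auto simp: X_def)
      show "x \<in> {b}"
      proof (rule ccontr)
        assume "x \<notin> {b}"
        with chain_4[OF x(1) a(2) b x(2) _ a(1)] that
        have "chain [x, y, a, b]" "card (set [x, y, a, b] \<inter> A) = 1"
          by (auto simp: Y_def)
        then have "chain [x, y, a, b] \<and> length [x, y, a, b] = 4 \<and>
            card (set [x, y, a, b] \<inter> A) = 1 \<and> h < \<iota> (hd [x, y, a, b])"
          using x(3) by simp
        with no show False
          by blast
      qed
    qed
    then show ?thesis
      using card_mono[of "{b}"] by fastforce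
  qed
  have "arc_count E X Y = arc_count E\<inverse>\<inverse> Y X"
    using arc_count_conversep[OF fin(1,3)] by simp
  also have "\<dots> \<le> card Y * 1"
    by (rule arc_count_le) (use inX in auto)
  finally have XY: "arc_count E X Y \<le> card Y"
    by simp
  have U_eq: "U = Y \<union> T \<union> {v}" and dj: "Y \<inter> T = {}" "(Y \<union> T) \<inter> {v} = {}"
    using v_in_U sub v_T by (auto simp: Y_def)
  have cY: "card Y + card T + 1 = 2 * d"
    using card_U fin dj unfolding U_eq by (simp add: card_Un_disjoint)
  have split: "arc_count E S U \<le> arc_count E S Y + arc_count E S T + card S" if "finite S" for S
  proof -
    have "arc_count E S U = arc_count E S (Y \<union> T) + arc_count E S {v}"
      unfolding U_eq using fin dj by (intro arc_count_Un_right) auto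
    also have "arc_count E S (Y \<union> T) = arc_count E S Y + arc_count E S T"
      using fin dj by (intro arc_count_Un_right) auto
    finally show ?thesis
      using arc_count_le_card[of "{v}" E S] by simp
  qed
  have T_le: "card T \<le> d"
  proof -
    obtain a where a: "a \<in> A"
      using card_A d_pos by fastforce
    have "T \<subseteq> outn E a"
    proof
      fix u assume "u \<in> T"
      then have "u \<in> U" "a \<notin> outn E u"
        using a by (auto simp: T_def)
      then show "u \<in> outn E a"
        using nbrs_A[OF a] by auto
    qed
    then show ?thesis
      using card_outn_A[OF a] card_mono[OF finite_outn] by metis
  qed
  \<comment> \<open>Vertices of \<open>T\<close> have at least \<open>d\<close> out-neighbours in
    \<open>U\<close>, but few arcs go to \<open>Y\<close>. For \<open>|T| \<ge> 3\<close> the count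
    has the factor \<open>|T| - 2\<close> on both sides and reduces to
    \<open>2d \<le> |T| + 1\<close>, against \<open>|T| \<le> d\<close>.\<close>
  have T_2: "card T \<le> 2"
  proof (rule ccontr)
    assume "\<not> card T \<le> 2"
    then obtain t where t: "card T = t + 3"
      by (metis add.commute le_Suc_ex not_less_eq_eq numeral_3_eq_3 numeral_2_eq_2)
    have "card T * d \<le> arc_count E T U"
      using outdeg_U \<iota>_T sub fin by (intro arc_count_ge) fastforce+
    also note split[OF fin(2)]
    also have "arc_count E T Y \<le> arc_count E X Y"
      unfolding arc_count_def using TX fin by (intro sum_mono2) auto
    finally have "card T * d \<le> card Y + arc_count E T T + card T"
      using XY by linarith
    moreover have "2 * arc_count E T T + card T \<le> card T * card T"
      by (rule arc_count_self[OF fin(2) asym])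
    ultimately have "2 * (card T * d) \<le> 2 * card Y + card T * card T + card T"
      by linarith
    with cY have "2 * (card T * d) + card T + 2 \<le> 4 * d + card T * card T"
      by linarith
    then have "2 * (t + 1) * d \<le> (t + 1) * (t + 4)"
      unfolding t by (simp add: algebra_simps)
    then have "2 * d \<le> t + 4"
      by (simp only: mult.assoc mult.left_commute[of 2] mult_le_cancel1)
    with T_le t h show False
      by simp
  qed
  have "(\<Sum>u\<in>U. \<iota> u) = (\<Sum>u\<in>X. \<iota> u) + (\<Sum>u\<in>U - X. \<iota> u)"
    using sub(1) finite_U by (simp add: sum.subset_diff)
  also have "(\<Sum>u\<in>U - X. \<iota> u) \<le> of_nat (card (U - X)) * h"
    using \<iota>_v by (intro sum_bounded_above) (force simp: X_def)
  also have "\<dots> \<le> 2 * d * h"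
    using card_mono[OF finite_U, of "U - X"] card_U by simp
  also have "(\<Sum>u\<in>X. \<iota> u) \<le> arc_count E X U"
    unfolding arc_count_def using outdeg_U sub by (intro sum_mono) auto
  also note split[OF fin(1)]
  also have "arc_count E X T \<le> card X * 2"
    using arc_count_le_card[OF fin(2), of E X] T_2 mult_le_mono2 le_trans by blast
  finally have "d * d \<le> card Y + 3 * card X + 2 * d * h"
    using XY sum_\<iota> by linarith
  moreover have "card X \<le> 2 * d"
    using card_mono[OF finite_U sub(1)] card_U by simp
  ultimately have "d * d \<le> d * (8 + 2 * h)"
    using cY by (simp add: algebra_simps)
  then show False
    using h d_pos by simp
qed

lemma chain_Cons2:
  assumes "chain xs" "E u a" "E a (hd xs)" "u \<in> U" "a \<in> A" "u \<notin> set xs" "a \<notin> set xs" "u \<noteq> v"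
  shows "chain (u # a # xs)" "card (set (u # a # xs) \<inter> A) = card (set xs \<inter> A) + 1"
    "card (set (u # a # xs) \<inter> U) = card (set xs \<inter> U) + 1"
proof -
  have "u \<notin> A" "a \<notin> U" "a \<noteq> v" "u \<noteq> a"
    using assms A_Int_U v_in_U by blast+
  then show "chain (u # a # xs)" "card (set (u # a # xs) \<inter> A) = card (set xs \<inter> A) + 1"
    "card (set (u # a # xs) \<inter> U) = card (set xs \<inter> U) + 1"
    using assms A_Un_U by (auto simp: chain_def successively_Cons)
qed

lemma chain_Cons3:
  assumes "chain xs" "E x y" "E y a" "E a (hd xs)" "x \<in> U" "y \<in> U" "a \<in> A"
    "x \<notin> set xs" "y \<notin> set xs" "a \<notin> set xs" "x \<noteq> v" "y \<noteq> v"
  shows "chain (x # y # a # xs)" "card (set (x # y # a # xs) \<inter> A) = card (set xs \<inter> A) + 1"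
    "card (set (x # y # a # xs) \<inter> U) = card (set xs \<inter> U) + 2"
proof -
  have "x \<notin> A" "y \<notin> A" "a \<notin> U" "a \<noteq> v" "x \<noteq> a" "y \<noteq> a" "x \<noteq> y"
    using assms A_Int_U v_in_U irrefl by blast+
  then show "chain (x # y # a # xs)" "card (set (x # y # a # xs) \<inter> A) = card (set xs \<inter> A) + 1"
    "card (set (x # y # a # xs) \<inter> U) = card (set xs \<inter> U) + 2"
    using assms A_Un_U by (auto simp: chain_def successively_Cons)
qed

text \<open>Each step prepends a fresh \<open>a \<in> A\<close> before the head and then an
  in-neighbour of \<open>a\<close>. Of the \<open>d\<close> in-neighbours of \<open>a\<close>, those
  with \<open>\<iota> \<le> h\<close> and those already used are too few to block a continuation
  with \<open>\<iota> > h\<close>.\<close>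

lemma two_step_chains:
  assumes "chain xs" "h < \<iota> (hd xs)" "card (set xs \<inter> A) + j \<le> h"
    "card {u \<in> U. \<iota> u \<le> h} + card (set xs \<inter> U) + j \<le> d"
  shows "\<exists>ys. chain ys \<and> h < \<iota> (hd ys) \<and> length ys = length xs + 2 * j \<and>
    card (set ys \<inter> A) = card (set xs \<inter> A) + j"
proof -
  define S where "S = {u \<in> U. \<iota> u \<le> h}"
  have "\<exists>ys. chain ys \<and> h < \<iota> (hd ys) \<and> length ys = length xs + 2 * i \<and>
      card (set ys \<inter> A) = card (set xs \<inter> A) + i \<and> card (set ys \<inter> U) = card (set xs \<inter> U) + i"
    if "i \<le> j" for i
    using that
  proof (induction i)
    case 0
    then show ?case
      using assms by auto
  next
    case (Suc i)
    then obtain ys where ys: "chain ys" "h < \<iota> (hd ys)" "length ys = length xs + 2 * i"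
      "card (set ys \<inter> A) = card (set xs \<inter> A) + i" "card (set ys \<inter> U) = card (set xs \<inter> U) + i"
      by auto
    have "card (set ys \<inter> A) < card (inn E (hd ys) \<inter> A)"
      using ys(2,4) assms(3) Suc.prems by (simp add: \<iota>_def)
    then have "\<not> inn E (hd ys) \<inter> A \<subseteq> set ys \<inter> A"
      using card_mono[of "set ys \<inter> A" "inn E (hd ys) \<inter> A"] by auto
    then obtain a where a: "E a (hd ys)" "a \<in> A" "a \<notin> set ys"
      unfolding inn_def by blast
    have "card (S \<union> (set ys \<inter> U)) \<le> card S + card (set ys \<inter> U)"
      by (rule card_Un_le)
    also have "\<dots> < card (inn E a)"
      using assms(4) Suc.prems ys(5) card_inn_A[OF a(2)] by (simp add: S_def)
    finally have "\<not> inn E a \<subseteq> S \<union> (set ys \<inter> U)"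
      using card_mono[of "S \<union> (set ys \<inter> U)" "inn E a"] finite_U by (auto simp: S_def)
    then obtain u where "E u a" "u \<notin> S" "u \<notin> set ys" "u \<in> U"
      using nbrs_A_subset(2)[OF a(2)] unfolding inn_def by blast
    then have u: "E u a" "u \<in> U" "u \<notin> set ys" "h < \<iota> u"
      by (auto simp: S_def)
    then have "u \<noteq> v"
      using \<iota>_v by auto
    from chain_Cons2[OF ys(1) u(1) a(1) u(2) a(2) u(3) a(3) this] show ?case
      using u(4) ys by (intro exI[of _ "u # a # ys"]) simp
  qed
  from this[of j] show ?thesis
    by auto
qed

section \<open>Long cycles when few vertices have small \<open>\<iota>\<close>\<close>

text \<open>A chain of \<open>3q - 2\<close> vertices is needed. It grows by \<open>h - 1\<close>
  double steps and then has \<open>h\<close> vertices in \<open>A\<close>, fewer than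
  \<open>\<iota>\<close> of its head.\<close>

lemma on_cycle_if_few_small_\<iota>:
  assumes q: "3 \<le> q" "15 * q \<le> d + 12" and h: "h = (3 * q - 3) div 2"
    and few: "card {u \<in> U. \<iota> u \<le> h} + (3 * q - 3 - h) < d"
  shows "on_cycle E (3 * q) v"
proof -
  have "\<exists>xs. chain xs \<and> h < \<iota> (hd xs) \<and> length xs = 3 * q - 2 - 2 * (h - 1) \<and> card (set xs \<inter> A) = 1"
  \<comment> \<open>The parity of \<open>q\<close> decides the initial piece: four vertices for even
    \<open>q\<close>, three for odd \<open>q\<close>.\<close>
  proof (cases "even q")
    case True
    then obtain p where p: "q = 2 * p"
      by (elim evenE)
    have "h + 2 = 3 * p"
      using q(1) unfolding h p by linarith
    then have "8 + 2 * h < d" "3 * q - 2 - 2 * (h - 1) = 4"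
      using q p by linarith+
    with ex_chain_4[of h] show ?thesis
      by auto
  next
    case False
    then have len: "3 * q - 2 - 2 * (h - 1) = 3"
      using q unfolding h by (auto elim!: oddE)
    obtain a where a: "a \<in> A"
      using card_A d_pos by fastforce
    obtain b where b: "E a b" "E b v"
      using ex_outn_inn_v[OF a] by blast
    have "\<not> inn E a \<subseteq> {u \<in> U. \<iota> u \<le> h}"
      using few card_inn_A[OF a] card_mono[of "{u \<in> U. \<iota> u \<le> h}" "inn E a"] finite_U by auto
    then obtain u where u: "E u a" "u \<in> U" "h < \<iota> u"
      using nbrs_A_subset(2)[OF a] not_le unfolding inn_def by blast
    have bU: "b \<in> U"
      using nbrs_A_subset(1)[OF a] b by auto
    have ne: "u \<noteq> v" "u \<noteq> b" "b \<noteq> v" "a \<noteq> v" "a \<noteq> b" "u \<noteq> a"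
      using u \<iota>_v asym[OF u(1)] b irrefl a v_in_U bU A_Int_U by auto
    have "chain [u, a, b]" "card (set [u, a, b] \<inter> A) = 1"
    proof -
      have "u \<notin> A" "b \<notin> A" "{u, a, b} \<subseteq> V"
        using u(2) a bU A_Int_U A_Un_U by blast+
      then show "chain [u, a, b]" "card (set [u, a, b] \<inter> A) = 1"
        using ne u a b by (auto simp: chain_def)
    qed
    with u(3) len show ?thesis
      by (intro exI[of _ "[u, a, b]"]) simp
  qed
  then obtain xs where xs: "chain xs" "h < \<iota> (hd xs)" "length xs = 3 * q - 2 - 2 * (h - 1)"
    "card (set xs \<inter> A) = 1"
    by blast
  have h2: "2 * h \<le> 3 * q - 3" "3 \<le> h"
    using q(1) unfolding h by linarith+
  have "\<exists>ys. chain ys \<and> h < \<iota> (hd ys) \<and> length ys = length xs + 2 * (h - 1) \<and>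
      card (set ys \<inter> A) = card (set xs \<inter> A) + (h - 1)"
    by (rule two_step_chains[OF xs(1,2)]) (use xs(3,4) chain_count[OF xs(1)] few h2 in auto)
  then obtain ys where ys: "chain ys" "h < \<iota> (hd ys)" "length ys = 3 * q - 2" "card (set ys \<inter> A) = h"
    using xs(3,4) h2 by auto
  have "on_cycle E (length ys + 2) v"
    by (rule on_cycle_if_chain[OF ys(1)]) (use ys in simp)
  moreover have "length ys + 2 = 3 * q"
    using ys(3) q(1) by linarith
  ultimately show ?thesis
    by simp
qed

section \<open>Long cycles when many vertices have small \<open>\<iota>\<close>\<close>

text \<open>A vertex \<open>y\<close> with few in-neighbours among the available vertices of small
  \<open>\<iota>\<close> still has at least \<open>d - h\<close> in-neighbours in \<open>U\<close>.
  If none had large \<open>\<iota>\<close>, many would lie in the middle range; then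
  \<open>S\<close> and \<open>M\<close> together would send more than the existing
  \<open>d * d\<close> arcs to \<open>A\<close>.\<close>

lemma ex_crossing_arc:
  assumes q: "3 \<le> q" "15 * q \<le> d + 12" and h: "h = (3 * q - 3) div 2"
    and many: "d \<le> card {u \<in> U. \<iota> u \<le> h} + (3 * q - 3 - h)"
    and F: "finite F" "v \<in> F" "card (F \<inter> U) + 2 \<le> 2 * q"
  shows "\<exists>x y. E x y \<and> x \<in> U - F \<and> y \<in> U - F \<and> h + q \<le> \<iota> x \<and> \<iota> y \<le> h"
proof (rule ccontr)
  assume no: "\<not> ?thesis"
  define S where "S = {u \<in> U. \<iota> u \<le> h}"
  define M where "M = {u \<in> U. h < \<iota> u \<and> \<iota> u < h + q}"
  define H where "H = S - F"
  have fin: "finite S" "finite M" "finite H"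
    using finite_U by (auto simp: S_def M_def H_def)
  have h2: "2 * h \<le> 3 * q - 3" "3 * q \<le> 2 * h + 4"
    using q(1) unfolding h by linarith+
  have vS: "v \<in> S \<inter> F"
    using v_in_U \<iota>_v F by (simp add: S_def)
  \<comment> \<open>Strictness, due to \<open>v\<close>, contributes to the constant 6 in the degree
    bound below.\<close>
  have "H \<subset> S"
    using vS by (auto simp: H_def)
  then have "card H < card S"
    by (rule psubset_card_mono[OF fin(1)])
  then have "card H + 1 \<le> card S"
    by simp
  have "card S \<le> card (H \<union> (F \<inter> U))"
    using F fin by (intro card_mono) (auto simp: H_def S_def)
  also have "\<dots> \<le> card H + card (F \<inter> U)"
    by (rule card_Un_le)
  finally have "0 < card H"
    using many[folded S_def] F(3) q h2 by linarith
  then have "H \<noteq> {}"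
    by auto
  with fin(3) have "\<exists>y\<in>H. 2 * card (outn E\<inverse>\<inverse> y \<inter> H) + 1 \<le> card H"
    by (rule ex_small_outdegree) (use asym in blast)
  then obtain y where y: "y \<in> H" "2 * card (inn E y \<inter> H) + 1 \<le> card H"
    by auto
  have yU: "y \<in> U" "\<iota> y \<le> h" "y \<notin> F"
    using y(1) by (auto simp: H_def S_def)
  have "inn E y \<inter> U \<subseteq> (inn E y \<inter> H) \<union> M \<union> (F \<inter> U)"
  proof
    fix x assume x: "x \<in> inn E y \<inter> U"
    have "\<iota> x < h + q" if "x \<notin> F"
    proof (rule ccontr)
      assume "\<not> \<iota> x < h + q"
      then have "h + q \<le> \<iota> x"
        by simp
      moreover have "E x y" "x \<in> U"
        using x by auto
      ultimately show False
        using no yU that by blast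
    qed
    with x show "x \<in> (inn E y \<inter> H) \<union> M \<union> (F \<inter> U)"
      by (auto simp: H_def S_def M_def)
  qed
  then have "card (inn E y \<inter> U) \<le> card ((inn E y \<inter> H) \<union> M \<union> (F \<inter> U))"
    using fin F by (intro card_mono) auto
  also have "\<dots> \<le> card (inn E y \<inter> H) + card M + card (F \<inter> U)"
    by (meson card_Un_le add_le_mono1 le_trans)
  finally have "2 * (d - h) + 6 \<le> card S + 2 * card M + 4 * q"
    using indeg_U[OF yU(1)] yU(2) y(2) F(3) \<open>card H + 1 \<le> card S\<close> q(1) by linarith
  moreover have "card S * (d - h) + card M * (d - (h + q) + 1) \<le> d * d"
  proof -
    have "card S * (d - h) \<le> arc_count E S A"
    proof (rule arc_count_ge[OF fin(1)])
      fix u assume "u \<in> S"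
      then have "u \<in> U" "\<iota> u \<le> h"
        by (auto simp: S_def)
      then show "d - h \<le> card (outn E u \<inter> A)"
        using card_outn_Int_A[of u] by linarith
    qed
    moreover have "card M * (d - (h + q) + 1) \<le> arc_count E M A"
    proof (rule arc_count_ge[OF fin(2)])
      fix u assume "u \<in> M"
      then have "u \<in> U" "\<iota> u < h + q"
        by (auto simp: M_def)
      then show "d - (h + q) + 1 \<le> card (outn E u \<inter> A)"
        using card_outn_Int_A[of u] h2 q by linarith
    qed
    moreover have "arc_count E S A + arc_count E M A = arc_count E (S \<union> M) A"
      using fin by (intro arc_count_Un_left[symmetric]) (auto simp: S_def M_def)
    moreover have "arc_count E (S \<union> M) A \<le> arc_count E U A"
      unfolding arc_count_def using finite_U by (intro sum_mono2) (auto simp: S_def M_def)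
    moreover have "arc_count E U A = d * d"
    proof -
      have "arc_count E U A = arc_count E\<inverse>\<inverse> A U"
        using arc_count_conversep[OF finite_U finite_A] by simp
      also have "\<dots> = (\<Sum>a\<in>A. d)"
        unfolding arc_count_def using nbrs_A_subset card_inn_A
        by (intro sum.cong refl) (simp add: Int_absorb2)
      finally show ?thesis
        by (simp add: card_A)
    qed
    ultimately show ?thesis
      by linarith
  qed
  ultimately show False
    using crossing_bound[OF q h] many by (simp add: S_def)
qed

text \<open>If \<open>\<iota> x\<close> is large and \<open>\<iota> y\<close> small, then many \<open>a \<in> A\<close> give a path \<open>y \<rightarrow> a \<rightarrow> x\<close>. Hence disjoint arcs
  from large to small \<open>\<iota>\<close> can be strung together in any order.\<close>

lemma on_cycle_if_many_small_\<iota>: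
  assumes q: "3 \<le> q" "15 * q \<le> d + 12" and h: "h = (3 * q - 3) div 2"
    and many: "d \<le> card {u \<in> U. \<iota> u \<le> h} + (3 * q - 3 - h)"
  shows "on_cycle E (3 * q) v"
proof -
  note cross = ex_crossing_arc[OF q h many]
  have h2: "2 * h \<le> 3 * q - 3"
    using q(1) unfolding h by linarith
  have outA: "d \<le> card (outn E y \<inter> A) + h" if "y \<in> U" "\<iota> y \<le> h" for y
    using card_outn_Int_A[OF that(1)] that(2) by linarith
  have "\<exists>x y. E x y \<and> x \<in> U - {v} \<and> y \<in> U - {v} \<and> h + q \<le> \<iota> x \<and> \<iota> y \<le> h"
    by (rule cross) (use v_in_U q in auto)
  then obtain x1 y1 where e1: "E x1 y1" "x1 \<in> U - {v}" "y1 \<in> U - {v}" "h + q \<le> \<iota> x1" "\<iota> y1 \<le> h"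
    by blast
  have "card ({v, x1, y1} \<inter> U) \<le> card {v, x1, y1}"
    by (rule card_mono) auto
  also have "\<dots> \<le> 3"
    by (simp add: card_insert_if)
  finally have "card ({v, x1, y1} \<inter> U) \<le> 3" .
  then have "\<exists>x y. E x y \<and> x \<in> U - {v, x1, y1} \<and> y \<in> U - {v, x1, y1} \<and> h + q \<le> \<iota> x \<and> \<iota> y \<le> h"
    by (intro cross) (use q in auto)
  then obtain x2 y2 where e2: "E x2 y2" "x2 \<in> U - {v, x1, y1}" "y2 \<in> U - {v, x1, y1}"
    "h + q \<le> \<iota> x2" "\<iota> y2 \<le> h"
    by blast
  \<comment> \<open>Two disjoint arcs with a common continuation \<open>a\<close> are prepared
    because the successor \<open>b\<close> of \<open>a\<close> may coincide with one of the starting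
    vertices.\<close>
  have "outn E y1 \<inter> A \<inter> (outn E y2 \<inter> A) \<noteq> {}"
  proof
    assume "outn E y1 \<inter> A \<inter> (outn E y2 \<inter> A) = {}"
    then have "card (outn E y1 \<inter> A) + card (outn E y2 \<inter> A) = card ((outn E y1 \<inter> A) \<union> (outn E y2 \<inter> A))"
      using finite_A by (intro card_Un_disjoint[symmetric]) auto
    also have "\<dots> \<le> d"
      using card_A finite_A by (metis Int_lower2 Un_least card_mono)
    finally show False
      using outA[of y1] outA[of y2] e1 e2 q h2 by auto
  qed
  then obtain a where a: "a \<in> A" "E y1 a" "E y2 a"
    by auto
  obtain b where b: "E a b" "E b v"
    using ex_outn_inn_v[OF a(1)] by blast
  have "\<exists>xs. chain xs \<and> length xs = 4 \<and> card (set xs \<inter> A) = 1 \<and> h + q \<le> \<iota> (hd xs)"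
  proof (cases "b = x1")
    case False
    from chain_4[OF e1(1) a(2) b e1(2,3) a(1) this] e1(4) show ?thesis
      by (intro exI[of _ "[x1, y1, a, b]"]) simp
  next
    case True
    have "x2 \<in> U - {v}" "y2 \<in> U - {v}" "b \<noteq> x2"
      using e2 True by auto
    from chain_4[OF e2(1) a(3) b this(1,2) a(1) this(3)] e2(4) show ?thesis
      by (intro exI[of _ "[x2, y2, a, b]"]) simp
  qed
  then obtain xs where xs: "chain xs" "length xs = 4" "card (set xs \<inter> A) = 1" "h + q \<le> \<iota> (hd xs)"
    by blast
  have "\<exists>ys. chain ys \<and> h + q \<le> \<iota> (hd ys) \<and> length ys = 4 + 3 * i \<and> card (set ys \<inter> A) = 1 + i"
    if "i \<le> q - 2" for i
    using that
  proof (induction i)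
    case 0
    then show ?case
      using xs by auto
  next
    case (Suc i)
    then obtain ys where ys: "chain ys" "h + q \<le> \<iota> (hd ys)" "length ys = 4 + 3 * i" "card (set ys \<inter> A) = 1 + i"
      by auto
    then have cU: "card (set ys \<inter> U) = 3 + 2 * i"
      using chain_count[OF ys(1)] by simp
    have "card ((insert v (set ys)) \<inter> U) \<le> card (insert v (set ys \<inter> U))"
      by (intro card_mono) auto
    also have "\<dots> \<le> 4 + 2 * i"
      using card_insert_le_m1[of _ "set ys \<inter> U" v] by (simp add: card_insert_if cU)
    finally have "\<exists>x y. E x y \<and> x \<in> U - insert v (set ys) \<and> y \<in> U - insert v (set ys) \<and> h + q \<le> \<iota> x \<and> \<iota> y \<le> h"
      by (intro cross) (use q Suc.prems in auto)
    then obtain x y where e: "E x y" "x \<in> U - insert v (set ys)" "y \<in> U - insert v (set ys)"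
      "h + q \<le> \<iota> x" "\<iota> y \<le> h"
      by blast
    \<comment> \<open>The two sets have at least \<open>d - h\<close> and \<open>h + q\<close>
      elements in a set of size \<open>d\<close>, hence at least \<open>q\<close> in common, while
      the chain uses only \<open>1 + i\<close> vertices of \<open>A\<close>.\<close>
    have "\<not> outn E y \<inter> A \<inter> (inn E (hd ys) \<inter> A) \<subseteq> set ys \<inter> A"
    proof
      assume sub: "outn E y \<inter> A \<inter> (inn E (hd ys) \<inter> A) \<subseteq> set ys \<inter> A"
      have "card (outn E y \<inter> A) + card (inn E (hd ys) \<inter> A)
          = card ((outn E y \<inter> A) \<union> (inn E (hd ys) \<inter> A)) + card ((outn E y \<inter> A) \<inter> (inn E (hd ys) \<inter> A))"
        using finite_A by (intro card_Un_Int) auto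
      also have "card ((outn E y \<inter> A) \<union> (inn E (hd ys) \<inter> A)) \<le> d"
        using card_A finite_A by (metis Int_lower2 Un_least card_mono)
      also have "card ((outn E y \<inter> A) \<inter> (inn E (hd ys) \<inter> A)) \<le> card (set ys \<inter> A)"
        by (rule card_mono[OF _ sub]) simp
      finally show False
        using outA[of y] e ys(2,4) Suc.prems by (auto simp: \<iota>_def)
    qed
    then obtain a where a: "E y a" "E a (hd ys)" "a \<in> A" "a \<notin> set ys"
      unfolding inn_def outn_def by blast
    from chain_Cons3[OF ys(1) e(1) a(1,2) _ _ a(3) _ _ a(4)] e ys show ?case
      by (intro exI[of _ "x # y # a # ys"]) auto
  qed
  from this[of "q - 2"] obtain ys where ys: "chain ys" "h + q \<le> \<iota> (hd ys)" "length ys = 4 + 3 * (q - 2)"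
    "card (set ys \<inter> A) = 1 + (q - 2)"
    by auto
  have "on_cycle E (length ys + 2) v"
    by (rule on_cycle_if_chain[OF ys(1)]) (use ys q in linarith)
  moreover have "length ys + 2 = 3 * q"
    using ys(3) q by simp
  ultimately show ?thesis
    by simp
qed

lemma on_cycle_if_independent_outn:
  assumes "3 \<le> q" "15 * q \<le> d + 12"
  shows "on_cycle E (3 * q) v"
  using on_cycle_if_few_small_\<iota>[OF assms refl] on_cycle_if_many_small_\<iota>[OF assms refl] by linarith

lemma on_cycle_6_if_independent_outn:
  assumes "10 < d"
  shows "on_cycle E 6 v"
proof -
  obtain xs where "chain xs" "length xs = 4" "card (set xs \<inter> A) = 1" "1 < \<iota> (hd xs)"
    using ex_chain_4[of 1] assms by auto
  then show ?thesis
    using on_cycle_if_chain[of xs] by simp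
qed

end

section \<open>Reversal and combination of the cases\<close>

lemma (in semidegree_graph) on_cycle_if_independent_inn:
  assumes "v \<in> V" "\<And>x y. E x v \<Longrightarrow> E y v \<Longrightarrow> \<not> E x y"
  shows "3 \<le> q \<Longrightarrow> 15 * q \<le> d + 12 \<Longrightarrow> on_cycle E (3 * q) v" "10 < d \<Longrightarrow> on_cycle E 6 v"
proof -
  interpret conv: semidegree_graph V "E\<inverse>\<inverse>" d
    by (rule converse_graph)
  have *: "independent_outn_graph V E\<inverse>\<inverse> d v" if "0 < d"
  proof
    show "v \<in> V" "0 < d"
      by (fact assms(1) that)+
    show "E\<inverse>\<inverse> v x \<Longrightarrow> E\<inverse>\<inverse> v y \<Longrightarrow> \<not> E\<inverse>\<inverse> x y" for x y
      using assms(2)[of y x] by simp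
  qed
  show "on_cycle E (3 * q) v" if "3 \<le> q" "15 * q \<le> d + 12"
    by (rule on_cycle_conversep, rule independent_outn_graph.on_cycle_if_independent_outn[OF * that])
      (use that in simp)
  show "on_cycle E 6 v" if "10 < d"
    by (rule on_cycle_conversep, rule independent_outn_graph.on_cycle_6_if_independent_outn[OF * that])
      (use that in simp)
qed

lemma (in semidegree_graph) on_cycle_multiple_of_3:
  assumes "v \<in> V" and q: "q = 2 \<and> 10 < d \<or> 3 \<le> q \<and> 15 * q \<le> d + 12"
  shows "on_cycle E (3 * q) v"
proof -
  have "0 < d"
    using q by auto
  consider "\<And>x y. E v x \<Longrightarrow> E v y \<Longrightarrow> \<not> E x y" | "\<And>x y. E x v \<Longrightarrow> E y v \<Longrightarrow> \<not> E x y"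
    | a s y b where "E v a" "E v s" "E a s" "E y v" "E b v" "E y b"
    by blast
  then show ?thesis
  proof cases
    case 1
    interpret independent_outn_graph V E d v
      by unfold_locales (fact assms(1) \<open>0 < d\<close> 1)+
    show ?thesis
      using q on_cycle_if_independent_outn on_cycle_6_if_independent_outn by auto
  next
    case 2
    show ?thesis
      using q on_cycle_if_independent_inn[OF assms(1) 2] by auto
  next
    case 3
    then show ?thesis
      using q on_cycle_if_arcs_at_both_ends[of q v a s y b] on_cycle_6_if_arcs_at_both_ends[of v a s y b]
      by auto
  qed
qed

section \<open>Transfer to directed graphs with named arcs\<close>

lemma (in wf_digraph) lies_on_directed_cycle_if_on_cycle:
  assumes "on_cycle (\<lambda>x y. (x, y) \<in> arcs_ends G) l v"
  shows "lies_on_directed_cycle G l v"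
proof -
  define arc where "arc x y = (SOME e. e \<in> arcs G \<and> tail G e = x \<and> head G e = y)" for x y
  have arc: "arc x y \<in> arcs G \<and> tail G (arc x y) = x \<and> head G (arc x y) = y"
    if "(x, y) \<in> arcs_ends G" for x y
    unfolding arc_def by (rule someI_ex) (use that in \<open>auto simp: arcs_ends_def arc_to_ends_def\<close>)
  obtain xs where xs: "distinct xs" "length xs = l" "v \<in> set xs"
    "successively (\<lambda>x y. (x, y) \<in> arcs_ends G) xs" "(last xs, hd xs) \<in> arcs_ends G"
    using assms by (auto simp: on_cycle_def)
  \<comment> \<open>The list of arcs along the vertex list, with the last arc leading to
    \<open>z\<close>; taking the first vertex for \<open>z\<close> closes the walk.\<close>
  define arcs_to where "arcs_to = rec_list (\<lambda>_. []) (\<lambda>x ys f z. arc x (if ys = [] then z else hd ys) # f z)"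
  have simps: "arcs_to [] z = []" "arcs_to (x # ys) z = arc x (if ys = [] then z else hd ys) # arcs_to ys z"
    for x z ys
    by (simp_all add: arcs_to_def)
  have walk: "set (arcs_to ys z) \<subseteq> arcs G \<and> cas (hd ys) (arcs_to ys z) z \<and> map (tail G) (arcs_to ys z) = ys"
    if "ys \<noteq> []" "successively (\<lambda>x y. (x, y) \<in> arcs_ends G) ys" "(last ys, z) \<in> arcs_ends G" for ys z
    using that
  proof (induction ys)
    case (Cons x ys)
    then show ?case
      using arc by (cases "ys = []") (auto simp: simps successively_Cons)
  qed simp
  define p where "p = arcs_to xs (hd xs)"
  have ne: "xs \<noteq> []"
    using xs by auto
  have p: "set p \<subseteq> arcs G" "cas (hd xs) p (hd xs)" "map (tail G) p = xs"
    using walk[OF ne xs(4,5)] by (auto simp: p_def)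
  have p_ne: "p \<noteq> []"
    using p(3) ne by auto
  have "hd xs \<in> verts G"
    using p(1) hd_in_set[OF p_ne] hd_map[OF p_ne, of "tail G"] p(3) by auto
  then have "awalk (hd xs) p (hd xs)"
    using p by (simp add: awalk_def)
  moreover have "head G (last p) = hd xs"
    using awlast_if_cas[OF p(2)] p_ne by (simp add: awalk_verts_conv)
  then have "awalk_verts (hd xs) p = xs @ [hd xs]"
    using p_ne p(3) by (simp add: awalk_verts_conv)
  then have "distinct (tl (awalk_verts (hd xs) p))"
    using xs(1) ne by (cases xs) auto
  ultimately have "cycle p"
    using p_ne by (auto simp: cycle_def)
  moreover have "length p = l"
    using p(3) xs(2) by (metis length_map)
  moreover have "v \<in> tail G ` set p"
    using p(3) xs(3) by (metis list.set_map)
  ultimately show ?thesis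
    by (auto simp: lies_on_directed_cycle_def)
qed

text \<open>Degrees count arcs, whereas the relation counts neighbours; the two agree because there
  are no parallel arcs.\<close>

lemma (in oriented_graph) semidegree_graph_arcs_ends:
  assumes "card (verts G) \<le> 3 * d" "\<And>v. v \<in> verts G \<Longrightarrow> d \<le> out_degree G v"
    "\<And>v. v \<in> verts G \<Longrightarrow> d \<le> in_degree G v"
  shows "semidegree_graph (verts G) (\<lambda>x y. (x, y) \<in> arcs_ends G) d"
proof
  show "finite (verts G)"
    by (rule finite_verts)
  show "card (verts G) \<le> 3 * d"
    by (rule assms(1))
  fix x y
  show "(x, y) \<in> arcs_ends G \<Longrightarrow> x \<in> verts G \<and> y \<in> verts G"
    by (auto simp: arcs_ends_def arc_to_ends_def)
  show "(x, y) \<in> arcs_ends G \<Longrightarrow> (y, x) \<notin> arcs_ends G"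
    by (rule no_opposite_arcs)
  have "outn (\<lambda>x y. (x, y) \<in> arcs_ends G) x = head G ` out_arcs G x"
    by (auto simp: arcs_ends_def arc_to_ends_def out_arcs_def)
  moreover have "inj_on (head G) (out_arcs G x)"
    by (rule inj_onI, rule no_multi_arcs) (auto simp: out_arcs_def arc_to_ends_def)
  ultimately show "x \<in> verts G \<Longrightarrow> d \<le> card (outn (\<lambda>x y. (x, y) \<in> arcs_ends G) x)"
    using assms(2)[of x] by (simp add: card_image out_degree_def)
  have "inn (\<lambda>x y. (x, y) \<in> arcs_ends G) x = tail G ` in_arcs G x"
    by (auto simp: arcs_ends_def arc_to_ends_def in_arcs_def)
  moreover have "inj_on (tail G) (in_arcs G x)"
    by (rule inj_onI, rule no_multi_arcs) (auto simp: in_arcs_def arc_to_ends_def)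
  ultimately show "x \<in> verts G \<Longrightarrow> d \<le> card (inn (\<lambda>x y. (x, y) \<in> arcs_ends G) x)"
    using assms(3)[of x] by (simp add: card_image in_degree_def)
qed

theorem theorem1p1:
  fixes G :: "('a, 'b) pre_digraph" and q n :: nat
  assumes "q \<ge> 2"
    and "n \<ge> n0 q"
    and "oriented_graph G"
    and "card (verts G) = n"
    and "int (min_semidegree G) \<ge> \<lceil>real n / 3\<rceil>"
  shows "\<forall>v \<in> verts G. lies_on_directed_cycle G (3 * q) v"
proof
  fix v assume v: "v \<in> verts G"
  interpret oriented_graph G
    by (rule assms(3))
  define d where "d = min_semidegree G"
  have "real n / 3 \<le> real d"
    using assms(5) by (simp add: d_def ceiling_le_iff)
  then have n: "n \<le> 3 * d"
    by linarith
  have deg: "d \<le> min (out_degree G u) (in_degree G u)" if "u \<in> verts G" for u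
    unfolding d_def min_semidegree_def using that finite_verts by (intro Min_le) auto
  interpret S: semidegree_graph "verts G" "\<lambda>x y. (x, y) \<in> arcs_ends G" d
    by (rule semidegree_graph_arcs_ends) (use n deg assms(4) in auto)
  \<comment> \<open>From \<open>n \<le> 3d\<close> the thresholds give \<open>d \<ge> 13\<close> for
    \<open>q = 2\<close>, \<open>d \<ge> 33 = 15 * 3 - 12\<close> for \<open>q = 3\<close>, and
    \<open>d \<ge> 15q - 2\<close> for \<open>q \<ge> 4\<close>.\<close>
  have "q = 2 \<and> 10 < d \<or> 3 \<le> q \<and> 15 * q \<le> d + 12"
    using assms(1,2) n by (auto simp: n0_def split: if_splits)
  then show "lies_on_directed_cycle G (3 * q) v"
    by (intro lies_on_directed_cycle_if_on_cycle S.on_cycle_multiple_of_3 v)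
qed

end
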